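(* Let $X_1,\ldots,X_n$ be i.i.d. $N_p(0,\Sigma_0)$, where $p=p_n$ and $s_0=s_{0,n}$ may depend on $n$. For a positive integer $s_0$ and a real number $\tau_0>1$, let $$\mathcal{U}(s_0,\tau_0)=\{\Sigma\in\mathcal{C}_p: |s(\Sigma)|\le s_0,\ \tau_0^{-1}\le\lambda_{\min}(\Sigma)\le\lambda_{\max}(\Sigma)\le\tau_0\}.$$ If $s_0^2(\log p)^3=O(p^2n)$ and $s_0^2=O(p^{3-\epsilon})$ for some small constant $\epsilon>0$, then $$\inf_{\hat\Sigma}\sup_{\Sigma_0\in\mathcal{U}(s_0,\tau_0)}\mathbb{E}_0\|\hat\Sigma-\Sigma_0\|_F^2\ \gtrsim\ \frac{s_0\log p}{n}\,I(s_0>3p)+\frac{p}{n},$$ where the infimum is over all estimators $\hat\Sigma$ (measurable functions of $X_1,\ldots,X_n$) and $\mathbb{E}_0$ is expectation under $\Sigma_0$.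
   Context: $\mathcal{C}_p$ is the set of $p\times p$ positive definite matrices; $|s(\Sigma)|$ is the number of nonzero off-diagonal entries of $\Sigma$; $\|\cdot\|_F$ is the Frobenius norm. $a_n=O(b_n)$ means $a_n/b_n$ is bounded; $a_n\gtrsim b_n$ means $b_n\le C a_n$ for a constant $C>0$ not depending on $n$. Asymptotics are as $n\to\infty$. *)

theory Defs
  imports "HOL-Probability.Probability" "Jordan_Normal_Form.Gauss_Jordan_Elimination"
    "Jordan_Normal_Form.Char_Poly"
begin

definition pos_def_mat :: "nat \<Rightarrow> real mat \<Rightarrow> bool" where
  "pos_def_mat p A \<longleftrightarrow> A \<in> carrier_mat p p \<and> transpose_mat A = A \<and>
     (\<forall>v \<in> carrier_vec p. v \<noteq> 0\<^sub>v p \<longrightarrow> v \<bullet> (A *\<^sub>v v) > 0)"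

definition lambda_min :: "real mat \<Rightarrow> real" where
  "lambda_min A = Min {k. eigenvalue A k}"

definition lambda_max :: "real mat \<Rightarrow> real" where
  "lambda_max A = Max {k. eigenvalue A k}"

definition offdiag_support :: "nat \<Rightarrow> real mat \<Rightarrow> nat" where
  "offdiag_support p A = card {(i, j). i < p \<and> j < p \<and> i \<noteq> j \<and> A $$ (i, j) \<noteq> 0}"

definition U_class :: "nat \<Rightarrow> nat \<Rightarrow> real \<Rightarrow> real mat set" where
  "U_class p s0 \<tau>0 = {S. pos_def_mat p S \<and> offdiag_support p S \<le> s0 \<and>
      1 / \<tau>0 \<le> lambda_min S \<and> lambda_min S \<le> lambda_max S \<and> lambda_max S \<le> \<tau>0}"

text \<open>Vectors in R^p are represented as functions nat => real on the index set {..<p}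
  (extensional), with the product Lebesgue measure.\<close>
definition Rp :: "nat \<Rightarrow> (nat \<Rightarrow> real) measure" where
  "Rp p = PiM {..<p} (\<lambda>_. lborel)"

definition gauss_density :: "nat \<Rightarrow> real mat \<Rightarrow> (nat \<Rightarrow> real) \<Rightarrow> real" where
  "gauss_density p S x =
     (let v = vec p x; Si = the (mat_inverse S) in
      exp (- (v \<bullet> (Si *\<^sub>v v)) / 2) / sqrt ((2 * pi) ^ p * det S))"

definition gaussian :: "nat \<Rightarrow> real mat \<Rightarrow> (nat \<Rightarrow> real) measure" where
  "gaussian p S = density (Rp p) (\<lambda>x. ennreal (gauss_density p S x))"

text \<open>Sample X_1..X_n i.i.d. N_p(0,S): X k is the (k+1)-th observation.\<close>
definition sample_measure :: "nat \<Rightarrow> nat \<Rightarrow> real mat \<Rightarrow> (nat \<Rightarrow> nat \<Rightarrow> real) measure" where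
  "sample_measure n p S = PiM {..<n} (\<lambda>_. gaussian p S)"

definition estimators :: "nat \<Rightarrow> nat \<Rightarrow> ((nat \<Rightarrow> nat \<Rightarrow> real) \<Rightarrow> nat \<Rightarrow> nat \<Rightarrow> real) set" where
  "estimators n p = {E. \<forall>i j. (\<lambda>X. E X i j) \<in> borel_measurable (PiM {..<n} (\<lambda>_. Rp p))}"

definition frob_sq :: "nat \<Rightarrow> (nat \<Rightarrow> nat \<Rightarrow> real) \<Rightarrow> real mat \<Rightarrow> real" where
  "frob_sq p E S = (\<Sum>i<p. \<Sum>j<p. (E i j - S $$ (i, j))^2)"

definition risk :: "nat \<Rightarrow> nat \<Rightarrow> ((nat \<Rightarrow> nat \<Rightarrow> real) \<Rightarrow> nat \<Rightarrow> nat \<Rightarrow> real) \<Rightarrow> real mat \<Rightarrow> ennreal" where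
  "risk n p E S = (\<integral>\<^sup>+ X. ennreal (frob_sq p (E X) S) \<partial>sample_measure n p S)"

definition minimax_risk :: "nat \<Rightarrow> nat \<Rightarrow> nat \<Rightarrow> real \<Rightarrow> ennreal" where
  "minimax_risk n p s0 \<tau>0 = (INF E \<in> estimators n p. SUP S \<in> U_class p s0 \<tau>0. risk n p E S)"

end

theory Submission
  imports Defs "HOL-Real_Asymp.Real_Asymp"
begin

text \<open>Both terms of the rate come from a packing argument. The hypotheses are \<open>\<Sigma> = I + A\<close> with \<open>A\<close>
  symmetric and of small absolute row sums. The second moment of the likelihood ratio of
  \<open>N(0, I + A)\<close> against \<open>N(0, I)\<close> is \<open>(det (I + A) det (I - A)) powr (-1/2) \<le> exp (4 \<parallel>A\<parallel>\<^sup>2)\<close>,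
  with \<open>\<parallel>A\<parallel>\<close> the Frobenius norm, so an \<open>n\<close>-sample cannot identify one out of \<open>M\<close> such hypotheses
  once \<open>exp (4 n \<parallel>A\<parallel>\<^sup>2) \<le> M / 4\<close>; the risk is then at least of the order of the squared separation.
  A greedy Hamming code supplies the hypotheses. For \<open>p / n\<close> the code words are put on the diagonal. For
  \<open>s0 log p / n\<close> the code consists of \<open>k \<times> k\<close> arrays of permutation matrices of size \<open>w\<close>, where
  \<open>k\<close> is about \<open>s0 / p\<close> and \<open>w\<close> about \<open>p / (2 k)\<close>: permutations keep both row and column sums
  equal to \<open>k\<close>, and there are about \<open>w ^ (k\<^sup>2 w)\<close> of them.\<close>

unbundle no inner_syntax and no vec_syntax

section \<open>Gaussian integrals\<close>

text \<open>\<open>lambda_min\<close> and \<open>lambda_max\<close> are \<open>Min\<close> and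
  \<open>Max\<close> over the set of real eigenvalues. Each hypothesis therefore leaves at least one
  coordinate uncoupled from the others: its unit vector is an explicit eigenvector, so the set is
  nonempty, and the row sum bound confines all eigenvalues to an interval around 1. In the sparse
  case the entries \<open>a\<close> satisfy a^2 ~ log w / n, and the row sums are of order k a. The
  assumption on s0^2 (log p)^3 makes them small; two of the three logarithms absorb its unknown
  constant. The assumption on s0^2 gives, for large p, k^2 <= p / 256 and hence w >= sqrt p, so log
  w and log p agree up to a factor 2. The Hamming ball bound costs a factor 2 sqrt q per position
  for an alphabet of size q, so binary codes are too poor: the diagonal uses 1024 levels, and the
  permutation blocks must be wide. The sparse bound needs p to exceed a fixed threshold, but p_n
  need not grow. Below the threshold s0 is bounded, and the sparse term is dominated by a multiple
  of p / n.\<close>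

definition qform :: "nat \<Rightarrow> real mat \<Rightarrow> (nat \<Rightarrow> real) \<Rightarrow> real" where
  "qform p A x = (\<Sum>i<p. \<Sum>j<p. A $$ (i, j) * x i * x j)"

lemma qform_vec:
  assumes "A \<in> carrier_mat p p"
  shows "vec p x \<bullet> (A *\<^sub>v vec p x) = qform p A x"
  using assms unfolding qform_def
  by (auto simp: scalar_prod_def sum_distrib_left mult_ac lessThan_atLeast0 intro!: sum.cong)

text \<open>\<open>Rp\<close> models vectors as functions on indices, so positivity is restated
  without \<open>vec\<close>. This form splits along the last coordinate, as Fubini and the
  inductions on \<open>p\<close> require.\<close>

lemma pos_def_mat_iff_qform:
  "pos_def_mat p A \<longleftrightarrow> A \<in> carrier_mat p p \<and> (\<forall>i<p. \<forall>j<p. A $$ (i, j) = A $$ (j, i)) \<and>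
     (\<forall>x. (\<exists>i<p. x i \<noteq> 0) \<longrightarrow> qform p A x > 0)" (is "_ \<longleftrightarrow> ?R")
proof
  assume L: "pos_def_mat p A"
  then have A: "A \<in> carrier_mat p p" and t: "transpose_mat A = A"
    and pd: "\<And>v. v \<in> carrier_vec p \<Longrightarrow> v \<noteq> 0\<^sub>v p \<Longrightarrow> v \<bullet> (A *\<^sub>v v) > 0"
    by (auto simp: pos_def_mat_def)
  have "A $$ (i, j) = A $$ (j, i)" if "i < p" "j < p" for i j
    using A that t by (metis carrier_matD index_transpose_mat(1))
  moreover have "qform p A x > 0" if "i < p" "x i \<noteq> 0" for i x
  proof -
    have "vec p x \<noteq> 0\<^sub>v p" using that by (metis index_vec index_zero_vec(1))
    then show ?thesis using pd[of "vec p x"] qform_vec[OF A] by simp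
  qed
  ultimately show ?R using A by auto
next
  assume R: ?R
  then have A: "A \<in> carrier_mat p p" by simp
  have t: "transpose_mat A = A" using R by (intro eq_matI) auto
  have "v \<bullet> (A *\<^sub>v v) > 0" if v: "v \<in> carrier_vec p" "v \<noteq> 0\<^sub>v p" for v
  proof -
    have e: "v = vec p (($) v)" using v by (intro eq_vecI) auto
    have "\<exists>i<p. v $ i \<noteq> 0"
    proof (rule ccontr)
      assume "\<not> ?thesis"
      then have "v = 0\<^sub>v p" using v by (intro eq_vecI) auto
      with v show False by simp
    qed
    then have "qform p A (($) v) > 0" using R by blast
    then show ?thesis using qform_vec[OF A, of "($) v"] e by simp
  qed
  then show "pos_def_mat p A" using A t by (auto simp: pos_def_mat_def)
qed

lemma qform_Suc:
  assumes "\<And>i. i < p \<Longrightarrow> A $$ (i, p) = A $$ (p, i)"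
  shows "qform (Suc p) A x = A $$ (p, p) * (x p)\<^sup>2 + 2 * (\<Sum>i<p. A $$ (p, i) * x i) * x p + qform p A x"
  unfolding qform_def using assms
  by (simp add: sum.distrib sum_distrib_left sum_distrib_right power2_eq_square algebra_simps)

lemma qform_cong:
  assumes "\<And>i j. i < p \<Longrightarrow> j < p \<Longrightarrow> A $$ (i, j) = B $$ (i, j)" "\<And>i. i < p \<Longrightarrow> x i = y i"
  shows "qform p A x = qform p B y"
  unfolding qform_def by (intro sum.cong refl) (auto simp: assms)

lemma qform_unit:
  assumes "i < p"
  shows "qform p A (\<lambda>j. if j = i then 1 else 0) = A $$ (i, i)"
proof -
  have "qform p A (\<lambda>j. if j = i then 1 else 0)
      = (\<Sum>k<p. if k = i then (\<Sum>j<p. if j = i then A $$ (i, i) else 0) else 0)"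
    unfolding qform_def by (intro sum.cong refl) (auto simp: if_distrib cong: if_cong)
  then show ?thesis using assms by simp
qed

text \<open>The pivot is the last index, not the first, so that eliminating it matches integration
  over the coordinate that \<open>{..<Suc p}\<close> adds to \<open>{..<p}\<close>.\<close>

definition schur_compl :: "nat \<Rightarrow> real mat \<Rightarrow> real mat" where
  "schur_compl p A = mat p p (\<lambda>(i, j). A $$ (i, j) - A $$ (p, i) * A $$ (p, j) / A $$ (p, p))"

lemma qform_schur:
  "qform p (schur_compl p A) x = qform p A x - (\<Sum>i<p. A $$ (p, i) * x i)\<^sup>2 / A $$ (p, p)"
proof -
  have "qform p (schur_compl p A) x = (\<Sum>i<p. \<Sum>j<p. A $$ (i, j) * x i * x j
      - (A $$ (p, i) * x i) * (A $$ (p, j) * x j) / A $$ (p, p))"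
    unfolding qform_def schur_compl_def by (intro sum.cong refl) (auto simp: algebra_simps)
  also have "\<dots> = qform p A x - (\<Sum>i<p. A $$ (p, i) * x i)\<^sup>2 / A $$ (p, p)"
    unfolding qform_def power2_eq_square
    by (simp add: sum_subtractf sum_product sum_divide_distrib)
  finally show ?thesis .
qed

text \<open>Block elimination: \<open>A\<close> is the product of a unit upper triangular matrix,
  carrying the last column divided by the pivot, and a block lower triangular one with
  \<open>schur_compl p A\<close> and the pivot on its diagonal.\<close>

lemma det_schur:
  assumes A: "A \<in> carrier_mat (Suc p) (Suc p)" and a: "A $$ (p, p) \<noteq> 0"
    and sym: "\<And>i. i < p \<Longrightarrow> A $$ (i, p) = A $$ (p, i)"
  shows "det A = A $$ (p, p) * det (schur_compl p A)"
proof -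
  define b where "b = mat p 1 (\<lambda>(i, j). A $$ (p, i) / A $$ (p, p))"
  define c where "c = mat 1 p (\<lambda>(i, j). A $$ (p, j))"
  define d where "d = mat 1 1 (\<lambda>(i, j). A $$ (p, p))"
  have dims: "b \<in> carrier_mat p 1" "c \<in> carrier_mat 1 p" "d \<in> carrier_mat 1 1"
    "schur_compl p A \<in> carrier_mat p p"
    by (auto simp: b_def c_def d_def schur_compl_def)
  let ?L = "four_block_mat (1\<^sub>m p) b (0\<^sub>m 1 p) (1\<^sub>m 1)"
  let ?R = "four_block_mat (schur_compl p A) (0\<^sub>m p 1) c d"
  have LR: "?L * ?R = four_block_mat (schur_compl p A + b * c) (b * d) c d"
    by (subst mult_four_block_mat[of _ p p _ 1 _ 1 _ _ p _ 1])
       (use dims in \<open>auto simp: left_mult_zero_mat right_mult_zero_mat\<close>)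
  have "A = ?L * ?R"
    unfolding LR using A a sym
    by (intro eq_matI) (auto simp: schur_compl_def b_def c_def d_def scalar_prod_def less_Suc_eq)
  also have "det (?L * ?R) = det ?L * det ?R"
    by (rule det_mult[of _ "p + 1"]) (use dims in auto)
  also have "det ?L = 1"
    by (subst det_four_block_mat_lower_left_zero[of _ p _ 1]) (use dims in auto)
  also have "det ?R = det (schur_compl p A) * det d"
    by (rule det_four_block_mat_upper_right_zero[of _ p _ 1]) (use dims in auto)
  also have "det d = A $$ (p, p)" by (simp add: d_def det_single)
  finally show ?thesis by simp
qed

text \<open>Completing the square: the integrand is a multiple of the normal density with mean
  \<open>- b / a\<close> and variance \<open>1 / a\<close>.\<close>

lemma nn_integral_gauss_1d:
  fixes a b c :: real
  assumes "a > 0"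
  shows "(\<integral>\<^sup>+y. ennreal (exp (- (a * y\<^sup>2 + 2 * b * y + c) / 2)) \<partial>lborel)
       = ennreal (sqrt (2 * pi / a) * exp (- (c - b\<^sup>2 / a) / 2))"
proof -
  let ?m = "- b / a" and ?s = "1 / sqrt a" and ?K = "sqrt (2 * pi / a) * exp (- (c - b\<^sup>2 / a) / 2)"
  have e: "exp (- (a * y\<^sup>2 + 2 * b * y + c) / 2) = ?K * normal_density ?m ?s y" for y
  proof -
    have "sqrt (2 * pi * ?s\<^sup>2) = sqrt (2 * pi / a)" using assms by (simp add: power_divide)
    moreover have "sqrt (2 * pi / a) > 0" using assms by simp
    moreover have "- (a * y\<^sup>2 + 2 * b * y + c) / 2
        = (- (c - b\<^sup>2 / a) / 2) + (- (y - ?m)\<^sup>2 / (2 * ?s\<^sup>2))"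
      using assms by (simp add: power_divide field_simps power2_eq_square)
    ultimately show ?thesis
      unfolding normal_density_def using assms by (simp add: exp_add[symmetric])
  qed
  have "(\<integral>\<^sup>+y. ennreal (exp (- (a * y\<^sup>2 + 2 * b * y + c) / 2)) \<partial>lborel)
      = (\<integral>\<^sup>+y. ennreal ?K * ennreal (normal_density ?m ?s y) \<partial>lborel)"
    unfolding e using assms by (intro nn_integral_cong) (simp add: ennreal_mult)
  also have "\<dots> = ennreal ?K * (\<integral>\<^sup>+y. ennreal (normal_density ?m ?s y) \<partial>lborel)"
    by (rule nn_integral_cmult) simp
  also have "(\<integral>\<^sup>+y. ennreal (normal_density ?m ?s y) \<partial>lborel) = 1"
    using assms by (subst nn_integral_eq_integral) auto
  finally show ?thesis by simp
qed

lemma product_sigma_finite_lborel: "product_sigma_finite (\<lambda>_::nat. lborel :: real measure)"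
  by (simp add: product_sigma_finite_def sigma_finite_lborel)

lemma qform_measurable [measurable]: "qform p A \<in> borel_measurable (Rp p)"
  unfolding qform_def Rp_def by measurable

text \<open>Induction on the dimension: integrating out the last coordinate leaves the Gaussian
  integral of the Schur complement, and the factor \<open>sqrt (2 * pi / a)\<close> matches the
  pivot extracted by \<open>det_schur\<close>. Positivity of the determinant is carried along in the
  same induction.\<close>

theorem gaussian_integral:
  assumes "pos_def_mat p A"
  shows "det A > 0 \<and>
    (\<integral>\<^sup>+x. ennreal (exp (- qform p A x / 2)) \<partial>Rp p) = ennreal (sqrt ((2 * pi) ^ p / det A))"
  using assms
proof (induction p arbitrary: A)
  case 0
  then have "A \<in> carrier_mat 0 0" by (simp add: pos_def_mat_def)
  then have "det A = 1" by (simp add: det_dim_zero)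
  then show ?case by (simp add: qform_def Rp_def PiM_empty nn_integral_count_space_finite)
next
  case (Suc p)
  interpret product_sigma_finite "\<lambda>_::nat. lborel :: real measure"
    by (rule product_sigma_finite_lborel)
  have A: "A \<in> carrier_mat (Suc p) (Suc p)"
    and sym: "\<And>i j. i < Suc p \<Longrightarrow> j < Suc p \<Longrightarrow> A $$ (i, j) = A $$ (j, i)"
    and pos: "\<And>x. (\<exists>i<Suc p. x i \<noteq> 0) \<Longrightarrow> qform (Suc p) A x > 0"
    using Suc.prems unfolding pos_def_mat_iff_qform by blast+
  let ?a = "A $$ (p, p)" and ?S = "schur_compl p A"
  let ?b = "\<lambda>x. \<Sum>i<p. A $$ (p, i) * x i"
  have a: "?a > 0"
    using pos[of "\<lambda>j. if j = p then 1 else 0"] qform_unit[of p "Suc p" A] by auto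
  have sum_upd: "(\<Sum>i<p. A $$ (p, i) * (x(p := y)) i) = ?b x" for x y
    by (intro sum.cong) auto
  have split: "qform (Suc p) A (x(p := y)) = ?a * y\<^sup>2 + 2 * ?b x * y + qform p A x" for x y
    by (subst qform_Suc) (use sym in \<open>auto simp: sum_upd intro!: qform_cong\<close>)
  have S: "pos_def_mat p ?S"
    unfolding pos_def_mat_iff_qform
  proof (intro conjI allI impI)
    show "?S \<in> carrier_mat p p" by (simp add: schur_compl_def)
    show "?S $$ (i, j) = ?S $$ (j, i)" if "i < p" "j < p" for i j
      using that sym by (auto simp: schur_compl_def)
    show "0 < qform p ?S x" if ex: "\<exists>i<p. x i \<noteq> 0" for x
    proof -
      \<comment> \<open>The minimiser of the quadratic in the last coordinate; there the form of
        \<open>A\<close> takes the value of the form of the Schur complement.\<close>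
      let ?y = "- ?b x / ?a"
      from ex have "\<exists>i<Suc p. (x(p := ?y)) i \<noteq> 0" by (auto intro: less_SucI)
      then have "0 < ?a * ?y\<^sup>2 + 2 * ?b x * ?y + qform p A x" using pos split by metis
      also have "\<dots> = qform p ?S x"
        unfolding qform_schur using a by (simp add: field_simps power2_eq_square)
      finally show ?thesis .
    qed
  qed
  note IH = Suc.IH[OF S]
  have det: "det A = ?a * det ?S"
    by (rule det_schur) (use A a sym in auto)
  have meas: "(\<lambda>x. ennreal (exp (- qform (Suc p) A x / 2))) \<in> borel_measurable (PiM (insert p {..<p}) (\<lambda>_. lborel))"
    using qform_measurable[of "Suc p" A] unfolding Rp_def lessThan_Suc by measurable
  have "(\<integral>\<^sup>+x. ennreal (exp (- qform (Suc p) A x / 2)) \<partial>Rp (Suc p))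
      = (\<integral>\<^sup>+x. (\<integral>\<^sup>+y. ennreal (exp (- (?a * y\<^sup>2 + 2 * ?b x * y + qform p A x) / 2)) \<partial>lborel) \<partial>Rp p)"
    unfolding Rp_def lessThan_Suc
    by (subst product_nn_integral_insert) (use meas in \<open>auto simp: split\<close>)
  also have "\<dots> = (\<integral>\<^sup>+x. ennreal (sqrt (2 * pi / ?a)) * ennreal (exp (- qform p ?S x / 2)) \<partial>Rp p)"
    using a by (intro nn_integral_cong, subst nn_integral_gauss_1d) (auto simp: qform_schur ennreal_mult)
  also have "\<dots> = ennreal (sqrt (2 * pi / ?a)) * (\<integral>\<^sup>+x. ennreal (exp (- qform p ?S x / 2)) \<partial>Rp p)"
    by (rule nn_integral_cmult) measurable
  also have "\<dots> = ennreal (sqrt ((2 * pi) ^ Suc p / det A))"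
    using IH a by (simp add: det ennreal_mult[symmetric] real_sqrt_mult[symmetric] real_sqrt_divide field_simps)
  finally show ?case using IH a det by simp
qed

section \<open>Small symmetric perturbations of the identity\<close>

text \<open>The elimination opposite to \<open>det_schur\<close>: the leading block keeps its
  entries and the last diagonal entry is corrected. When that block is invertible, \<open>u\<close>
  is its inverse applied to the last column.\<close>

lemma det_border:
  fixes A :: "real mat"
  assumes A: "A \<in> carrier_mat (Suc p) (Suc p)"
    and u: "\<And>i. i < p \<Longrightarrow> (\<Sum>j<p. A $$ (i, j) * u j) = A $$ (i, p)"
  shows "det A = det (mat p p (($$) A)) * (A $$ (p, p) - (\<Sum>j<p. A $$ (p, j) * u j))"
proof -
  define C where "C = mat p p (($$) A)"
  define c where "c = mat 1 p (\<lambda>(i, j). A $$ (p, j))"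
  define U where "U = mat p 1 (\<lambda>(i, j). u i)"
  define d where "d = mat 1 1 (\<lambda>(i::nat, j::nat). A $$ (p, p) - (\<Sum>j<p. A $$ (p, j) * u j))"
  have dims: "C \<in> carrier_mat p p" "c \<in> carrier_mat 1 p" "U \<in> carrier_mat p 1" "d \<in> carrier_mat 1 1"
    by (auto simp: C_def c_def U_def d_def)
  let ?L = "four_block_mat C (0\<^sub>m p 1) c (1\<^sub>m 1)"
  let ?R = "four_block_mat (1\<^sub>m p) U (0\<^sub>m 1 p) d"
  have LR: "?L * ?R = four_block_mat C (C * U) c (c * U + d)"
    by (subst mult_four_block_mat[of _ p p _ 1 _ 1 _ _ p _ 1])
       (use dims in \<open>auto simp: left_mult_zero_mat right_mult_zero_mat\<close>)
  have "A = ?L * ?R"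
    unfolding LR using A u
    by (intro eq_matI)
       (auto simp: C_def c_def U_def d_def scalar_prod_def less_Suc_eq lessThan_atLeast0[symmetric])
  also have "det (?L * ?R) = det ?L * det ?R"
    by (rule det_mult[of _ "p + 1"]) (use dims in auto)
  also have "det ?L = det C"
    by (subst det_four_block_mat_upper_right_zero[of _ p _ 1]) (use dims in auto)
  also have "det ?R = det d"
    by (subst det_four_block_mat_lower_left_zero[of _ p _ 1]) (use dims in auto)
  also have "det d = A $$ (p, p) - (\<Sum>j<p. A $$ (p, j) * u j)" by (simp add: d_def det_single)
  finally show ?thesis by (simp add: C_def)
qed

lemma det_nonzero_solve:
  fixes C :: "real mat"
  assumes C: "C \<in> carrier_mat p p" and d: "det C \<noteq> 0"
  obtains u :: "nat \<Rightarrow> real" where "\<And>i. i < p \<Longrightarrow> (\<Sum>j<p. C $$ (i, j) * u j) = b i"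
proof -
  obtain B where B: "B \<in> carrier_mat p p" "C * B = 1\<^sub>m p"
    using det_non_zero_imp_unit[OF C d, where b = p] C
    by (auto simp: Units_def ring_mat_def)
  let ?u = "\<lambda>i. (B *\<^sub>v vec p b) $ i"
  have "C *\<^sub>v (B *\<^sub>v vec p b) = vec p b"
    using B C by (simp add: assoc_mult_mat_vec[symmetric])
  then have "(\<Sum>j<p. C $$ (i, j) * ?u j) = b i" if "i < p" for i
  proof -
    have "(C *\<^sub>v (B *\<^sub>v vec p b)) $ i = (\<Sum>j<p. C $$ (i, j) * ?u j)"
      using that B C by (subst index_mult_mat_vec) (auto simp: scalar_prod_def lessThan_atLeast0)
    then show ?thesis using \<open>C *\<^sub>v (B *\<^sub>v vec p b) = vec p b\<close> that by simp
  qed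
  then show thesis by (rule that)
qed

lemma pos_def_matI_qform_ge:
  assumes "A \<in> carrier_mat p p" "\<And>i j. i < p \<Longrightarrow> j < p \<Longrightarrow> A $$ (i, j) = A $$ (j, i)"
    and "c > 0" "\<And>x. qform p A x \<ge> c * (\<Sum>i<p. (x i)\<^sup>2)"
  shows "pos_def_mat p A"
  unfolding pos_def_mat_iff_qform
proof (intro conjI allI impI)
  fix x :: "nat \<Rightarrow> real" assume "\<exists>i<p. x i \<noteq> 0"
  then have "(\<Sum>i<p. (x i)\<^sup>2) > 0"
    by (auto intro!: sum_pos2)
  then show "qform p A x > 0" using assms(3) assms(4)[of x] by (smt (verit) mult_pos_pos)
qed (use assms in auto)

text \<open>The determinant is the product of the pivots. Each pivot is a diagonal entry minus
  \<open>t\<close>, the form of the inverse leading block at the part of the row left of the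
  diagonal; since that block is at least \<open>c\<close> times the identity, \<open>t\<close> is at
  most the squared length of this part divided by \<open>c\<close>.\<close>

lemma det_ge_prod_diag:
  assumes "A \<in> carrier_mat p p" "\<And>i j. i < p \<Longrightarrow> j < p \<Longrightarrow> A $$ (i, j) = A $$ (j, i)"
    and c: "c > 0" and "\<And>x. qform p A x \<ge> c * (\<Sum>i<p. (x i)\<^sup>2)"
    and "\<And>i. i < p \<Longrightarrow> A $$ (i, i) - (\<Sum>j<i. (A $$ (i, j))\<^sup>2) / c \<ge> 0"
  shows "det A \<ge> (\<Prod>i<p. A $$ (i, i) - (\<Sum>j<i. (A $$ (i, j))\<^sup>2) / c)"
  using assms(1,2,4,5)
proof (induction p arbitrary: A)
  case 0
  then show ?case by (simp add: det_dim_zero)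
next
  case (Suc p)
  note A = Suc.prems(1) and sym = Suc.prems(2) and ge = Suc.prems(3) and nn = Suc.prems(4)
  define C where "C = mat p p (($$) A)"
  have C: "C \<in> carrier_mat p p" by (simp add: C_def)
  have Cij: "C $$ (i, j) = A $$ (i, j)" if "i < p" "j < p" for i j using that by (simp add: C_def)
  have Csym: "C $$ (i, j) = C $$ (j, i)" if "i < p" "j < p" for i j
    using that sym by (simp add: Cij)
  have Cge: "qform p C x \<ge> c * (\<Sum>i<p. (x i)\<^sup>2)" for x
  proof -
    let ?y = "x(p := 0)"
    have "qform (Suc p) A ?y = qform p C x"
      by (subst qform_Suc) (use sym in \<open>auto intro!: qform_cong simp: Cij\<close>)
    moreover have "(\<Sum>i<Suc p. (?y i)\<^sup>2) = (\<Sum>i<p. (x i)\<^sup>2)" by (auto intro!: sum.cong)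
    ultimately show ?thesis using ge[of ?y] by metis
  qed
  have dC: "det C > 0"
    using gaussian_integral[OF pos_def_matI_qform_ge[OF C Csym c Cge]] by simp
  have IH: "(\<Prod>i<p. C $$ (i, i) - (\<Sum>j<i. (C $$ (i, j))\<^sup>2) / c) \<le> det C"
  proof (rule Suc.IH[OF C Csym Cge])
    fix i assume "i < p"
    then show "0 \<le> C $$ (i, i) - (\<Sum>j<i. (C $$ (i, j))\<^sup>2) / c"
      using nn[of i] by (simp add: Cij)
  qed
  obtain u where u: "\<And>i. i < p \<Longrightarrow> (\<Sum>j<p. C $$ (i, j) * u j) = A $$ (i, p)"
    using det_nonzero_solve[OF C, of "\<lambda>i. A $$ (i, p)"] dC by auto
  define t where "t = (\<Sum>j<p. A $$ (p, j) * u j)"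
  have det: "det A = det C * (A $$ (p, p) - t)"
    unfolding C_def t_def by (rule det_border[OF A]) (use u in \<open>simp add: Cij\<close>)
  have "qform p C u = (\<Sum>i<p. u i * (\<Sum>j<p. C $$ (i, j) * u j))"
    unfolding qform_def by (simp add: sum_distrib_left mult_ac)
  also have "\<dots> = t" unfolding t_def by (intro sum.cong) (auto simp: u sym)
  finally have t: "t \<ge> c * (\<Sum>i<p. (u i)\<^sup>2)" using Cge[of u] by simp
  \<comment> \<open>Young's inequality applied to \<open>2 * t\<close> produces the term
    \<open>c * (\<Sum>i<p. (u i)\<^sup>2)\<close>, which is at most \<open>t\<close> by coercivity
    and cancels against one of the two copies.\<close>
  have "2 * t = (\<Sum>j<p. 2 * (A $$ (p, j) * u j))" by (simp add: t_def sum_distrib_left)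
  also have "\<dots> \<le> (\<Sum>j<p. (A $$ (p, j))\<^sup>2 / c + c * (u j)\<^sup>2)"
  proof (rule sum_mono)
    fix j
    have "0 \<le> (A $$ (p, j) - c * u j)\<^sup>2 / c" using c by simp
    also have "\<dots> = (A $$ (p, j))\<^sup>2 / c + c * (u j)\<^sup>2 - 2 * (A $$ (p, j) * u j)"
      using c by (simp add: power2_eq_square field_simps)
    finally show "2 * (A $$ (p, j) * u j) \<le> (A $$ (p, j))\<^sup>2 / c + c * (u j)\<^sup>2" by simp
  qed
  also have "\<dots> = (\<Sum>j<p. (A $$ (p, j))\<^sup>2) / c + c * (\<Sum>i<p. (u i)\<^sup>2)"
    by (simp add: sum.distrib sum_divide_distrib sum_distrib_left)
  finally have tle: "t \<le> (\<Sum>j<p. (A $$ (p, j))\<^sup>2) / c" using t by linarith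
  have "(\<Prod>i<Suc p. A $$ (i, i) - (\<Sum>j<i. (A $$ (i, j))\<^sup>2) / c)
      = (\<Prod>i<p. C $$ (i, i) - (\<Sum>j<i. (C $$ (i, j))\<^sup>2) / c) * (A $$ (p, p) - (\<Sum>j<p. (A $$ (p, j))\<^sup>2) / c)"
    by (simp add: Cij)
  also have "\<dots> \<le> det C * (A $$ (p, p) - (\<Sum>j<p. (A $$ (p, j))\<^sup>2) / c)"
    by (rule mult_right_mono[OF IH]) (use nn[of p] in simp)
  also have "\<dots> \<le> det C * (A $$ (p, p) - t)"
    using dC tle by (intro mult_left_mono) auto
  finally show ?case by (simp add: det)
qed

section \<open>Symmetric matrices with small row sums\<close>

definition small_sym_mat :: "nat \<Rightarrow> real \<Rightarrow> real mat \<Rightarrow> bool" where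
  "small_sym_mat p r A \<longleftrightarrow> A \<in> carrier_mat p p \<and> (\<forall>i<p. \<forall>j<p. A $$ (i, j) = A $$ (j, i)) \<and>
     (\<forall>i<p. (\<Sum>j<p. \<bar>A $$ (i, j)\<bar>) \<le> r)"

lemma small_sym_matD:
  assumes "small_sym_mat p r A"
  shows "A \<in> carrier_mat p p" "i < p \<Longrightarrow> j < p \<Longrightarrow> A $$ (i, j) = A $$ (j, i)"
    "i < p \<Longrightarrow> (\<Sum>j<p. \<bar>A $$ (i, j)\<bar>) \<le> r"
  using assms by (auto simp: small_sym_mat_def)

text \<open>Schur's test: \<open>\<bar>x i * x j\<bar>\<close> is at most the mean of the two
  squares, and symmetry turns column sums into row sums. A row sum bound, which can be checked by
  counting entries, thus serves as an operator norm bound.\<close>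

lemma abs_qform_le:
  assumes "small_sym_mat p r A"
  shows "\<bar>qform p A x\<bar> \<le> r * (\<Sum>i<p. (x i)\<^sup>2)"
proof -
  have "\<bar>qform p A x\<bar> \<le> (\<Sum>i<p. \<Sum>j<p. \<bar>A $$ (i, j) * x i * x j\<bar>)"
    unfolding qform_def by (intro order_trans[OF sum_abs] sum_mono sum_abs)
  also have "\<dots> \<le> (\<Sum>i<p. \<Sum>j<p. \<bar>A $$ (i, j)\<bar> * (x i)\<^sup>2 / 2 + \<bar>A $$ (i, j)\<bar> * (x j)\<^sup>2 / 2)"
  proof (intro sum_mono)
    fix i j
    have "\<bar>x i\<bar> * \<bar>x j\<bar> \<le> ((x i)\<^sup>2 + (x j)\<^sup>2) / 2"
      using sum_squares_bound[of "\<bar>x i\<bar>" "\<bar>x j\<bar>"] by simp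
    from mult_left_mono[OF this, of "\<bar>A $$ (i, j)\<bar>"]
    show "\<bar>A $$ (i, j) * x i * x j\<bar> \<le> \<bar>A $$ (i, j)\<bar> * (x i)\<^sup>2 / 2 + \<bar>A $$ (i, j)\<bar> * (x j)\<^sup>2 / 2"
      by (simp add: abs_mult algebra_simps add_divide_distrib)
  qed
  also have "\<dots> = (\<Sum>i<p. \<Sum>j<p. \<bar>A $$ (i, j)\<bar> * (x i)\<^sup>2 / 2) + (\<Sum>i<p. \<Sum>j<p. \<bar>A $$ (i, j)\<bar> * (x j)\<^sup>2 / 2)"
    by (simp add: sum.distrib)
  also have "(\<Sum>i<p. \<Sum>j<p. \<bar>A $$ (i, j)\<bar> * (x j)\<^sup>2 / 2) = (\<Sum>i<p. \<Sum>j<p. \<bar>A $$ (i, j)\<bar> * (x i)\<^sup>2 / 2)"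
    by (subst sum.swap) (intro sum.cong refl, use small_sym_matD(2)[OF assms] in auto)
  also have "(\<Sum>i<p. \<Sum>j<p. \<bar>A $$ (i, j)\<bar> * (x i)\<^sup>2 / 2) = (\<Sum>i<p. (\<Sum>j<p. \<bar>A $$ (i, j)\<bar>) * ((x i)\<^sup>2 / 2))"
    by (simp add: sum_distrib_right sum_divide_distrib)
  also have "(\<Sum>i<p. (\<Sum>j<p. \<bar>A $$ (i, j)\<bar>) * ((x i)\<^sup>2 / 2)) + (\<Sum>i<p. (\<Sum>j<p. \<bar>A $$ (i, j)\<bar>) * ((x i)\<^sup>2 / 2))
     \<le> (\<Sum>i<p. r * ((x i)\<^sup>2 / 2)) + (\<Sum>i<p. r * ((x i)\<^sup>2 / 2))"
    by (intro add_mono sum_mono mult_right_mono) (use small_sym_matD(3)[OF assms] in auto)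
  also have "\<dots> = r * (\<Sum>i<p. (x i)\<^sup>2)"
    by (simp add: sum_distrib_left sum_divide_distrib[symmetric])
  finally show ?thesis .
qed

lemma small_sym_mat_square:
  assumes A: "small_sym_mat p r A" and r: "r \<ge> 0"
  shows "small_sym_mat p (r\<^sup>2) (A * A)"
  unfolding small_sym_mat_def
proof (intro conjI allI impI)
  note AD = small_sym_matD[OF A]
  show "A * A \<in> carrier_mat p p" using AD(1) by simp
  have ent: "(A * A) $$ (i, j) = (\<Sum>l<p. A $$ (i, l) * A $$ (l, j))" if "i < p" "j < p" for i j
    using that AD(1) by (simp add: scalar_prod_def lessThan_atLeast0)
  show "(A * A) $$ (i, j) = (A * A) $$ (j, i)" if "i < p" "j < p" for i j
    using that by (auto simp: ent AD(2) intro!: sum.cong)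
  show "(\<Sum>j<p. \<bar>(A * A) $$ (i, j)\<bar>) \<le> r\<^sup>2" if "i < p" for i
  proof -
    have "(\<Sum>j<p. \<bar>(A * A) $$ (i, j)\<bar>) \<le> (\<Sum>j<p. \<Sum>l<p. \<bar>A $$ (i, l)\<bar> * \<bar>A $$ (l, j)\<bar>)"
      using that by (intro sum_mono) (auto simp: ent abs_mult[symmetric] intro: sum_abs)
    also have "\<dots> = (\<Sum>l<p. \<bar>A $$ (i, l)\<bar> * (\<Sum>j<p. \<bar>A $$ (l, j)\<bar>))"
      by (subst sum.swap) (simp add: sum_distrib_left)
    also have "\<dots> \<le> (\<Sum>l<p. \<bar>A $$ (i, l)\<bar> * r)"
      by (intro sum_mono mult_left_mono) (use AD(3) in auto)
    also have "\<dots> = (\<Sum>l<p. \<bar>A $$ (i, l)\<bar>) * r" by (simp add: sum_distrib_right)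
    also have "\<dots> \<le> r * r" using AD(3)[OF that] r by (intro mult_right_mono)
    finally show ?thesis by (simp add: power2_eq_square)
  qed
qed

lemma qform_one: "qform p (1\<^sub>m p) x = (\<Sum>i<p. (x i)\<^sup>2)"
proof -
  have "qform p (1\<^sub>m p) x = (\<Sum>i<p. \<Sum>j<p. if j = i then (x i)\<^sup>2 else 0)"
    unfolding qform_def by (intro sum.cong refl) (auto simp: power2_eq_square)
  then show ?thesis by simp
qed

lemma qform_add:
  assumes "A \<in> carrier_mat p p" "B \<in> carrier_mat p p"
  shows "qform p (A + B) x = qform p A x + qform p B x"
  unfolding qform_def sum.distrib[symmetric] using assms
  by (intro sum.cong refl) (auto simp: algebra_simps)

lemma qform_smult:
  assumes "A \<in> carrier_mat p p"
  shows "qform p (c \<cdot>\<^sub>m A) x = c * qform p A x"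
  unfolding qform_def sum_distrib_left using assms
  by (intro sum.cong refl) (auto simp: algebra_simps)

lemma small_sym_mat_uminus:
  assumes "small_sym_mat p r A"
  shows "small_sym_mat p r (- A)"
  using assms unfolding small_sym_mat_def by auto

lemma qform_one_plus_ge:
  assumes "small_sym_mat p r A"
  shows "qform p (1\<^sub>m p + A) x \<ge> (1 - r) * (\<Sum>i<p. (x i)\<^sup>2)"
  using abs_qform_le[OF assms, of x] small_sym_matD(1)[OF assms]
  by (simp add: qform_add[of _ p] qform_one algebra_simps)

lemma pos_def_one_plus:
  assumes A: "small_sym_mat p r A" and r: "r < 1"
  shows "pos_def_mat p (1\<^sub>m p + A)"
  by (rule pos_def_matI_qform_ge[where c = "1 - r"])
     (use small_sym_matD[OF A] qform_one_plus_ge[OF A] r in \<open>auto\<close>)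

definition frob_norm_sq :: "nat \<Rightarrow> real mat \<Rightarrow> real" where
  "frob_norm_sq p A = (\<Sum>i<p. \<Sum>j<p. (A $$ (i, j))\<^sup>2)"

text \<open>The case \<open>c = 1/2\<close> of \<open>det_ge_prod_diag\<close>, within the
  coercivity constant \<open>1 - 1/4\<close>. The second claim supplies the nonnegativity needed to
  multiply the bounds for \<open>A\<close> and \<open>- A\<close>.\<close>

lemma det_one_plus_ge:
  assumes A: "small_sym_mat p (1/4) A"
  shows "det (1\<^sub>m p + A) \<ge> (\<Prod>i<p. 1 + A $$ (i, i) - 2 * (\<Sum>j<i. (A $$ (i, j))\<^sup>2))"
    and "i < p \<Longrightarrow> 1 + A $$ (i, i) - 2 * (\<Sum>j<i. (A $$ (i, j))\<^sup>2) \<ge> 0"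
proof -
  note AD = small_sym_matD[OF A]
  have ab: "\<bar>A $$ (i, j)\<bar> \<le> 1/4" if "i < p" "j < p" for i j
  proof -
    have "\<bar>A $$ (i, j)\<bar> \<le> (\<Sum>j<p. \<bar>A $$ (i, j)\<bar>)"
      using that by (intro member_le_sum) auto
    then show ?thesis using AD(3)[OF that(1)] by simp
  qed
  show nn: "1 + A $$ (i, i) - 2 * (\<Sum>j<i. (A $$ (i, j))\<^sup>2) \<ge> 0" if i: "i < p" for i
  proof -
    have "(\<Sum>j<i. (A $$ (i, j))\<^sup>2) \<le> (\<Sum>j<i. \<bar>A $$ (i, j)\<bar>)"
    proof (rule sum_mono)
      fix j assume "j \<in> {..<i}"
      then have "\<bar>A $$ (i, j)\<bar> \<le> 1/4" using i by (intro ab) auto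
      then have "\<bar>A $$ (i, j)\<bar> * \<bar>A $$ (i, j)\<bar> \<le> 1 * \<bar>A $$ (i, j)\<bar>" by (intro mult_right_mono) auto
      then show "(A $$ (i, j))\<^sup>2 \<le> \<bar>A $$ (i, j)\<bar>" by (simp add: power2_eq_square)
    qed
    also have "\<dots> \<le> (\<Sum>j<p. \<bar>A $$ (i, j)\<bar>)" using i by (intro sum_mono2) auto
    finally show ?thesis using AD(3)[OF i] ab[OF i i] by auto
  qed
  let ?B = "1\<^sub>m p + A"
  have "(\<Prod>i<p. ?B $$ (i, i) - (\<Sum>j<i. (?B $$ (i, j))\<^sup>2) / (1/2)) \<le> det ?B"
  proof (rule det_ge_prod_diag)
    show "?B \<in> carrier_mat p p" using AD(1) by simp
    show "?B $$ (i, j) = ?B $$ (j, i)" if "i < p" "j < p" for i j using that AD(1,2) by auto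
    have "(1 - 1/4) * (\<Sum>i<p. (x i)\<^sup>2) \<ge> 1/2 * (\<Sum>i<p. (x i)\<^sup>2)" for x :: "nat \<Rightarrow> real"
      by (intro mult_right_mono sum_nonneg) auto
    then show "1/2 * (\<Sum>i<p. (x i)\<^sup>2) \<le> qform p ?B x" for x
      using qform_one_plus_ge[OF A, of x] by (meson order_trans)
    show "0 \<le> ?B $$ (i, i) - (\<Sum>j<i. (?B $$ (i, j))\<^sup>2) / (1/2)" if "i < p" for i
      using nn[OF that] that AD(1) by simp
  qed simp
  also have "(\<Prod>i<p. ?B $$ (i, i) - (\<Sum>j<i. (?B $$ (i, j))\<^sup>2) / (1/2))
     = (\<Prod>i<p. 1 + A $$ (i, i) - 2 * (\<Sum>j<i. (A $$ (i, j))\<^sup>2))"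
    using AD(1) by (intro prod.cong refl) auto
  finally show "det ?B \<ge> \<dots>" .
qed

lemma exp_le_one_minus:
  fixes x :: real
  assumes "0 \<le> x" "x \<le> 1/2"
  shows "exp (- 2 * x) \<le> 1 - x"
proof -
  have "1 \<le> (1 + 2 * x) * (1 - x)"
  proof -
    have "x * (2 * x) \<le> x * 1" using assms by (intro mult_left_mono) auto
    then show ?thesis by (simp add: algebra_simps)
  qed
  also have "\<dots> \<le> exp (2 * x) * (1 - x)"
    using assms exp_ge_add_one_self[of "2 * x"] by (intro mult_right_mono) auto
  finally show ?thesis by (simp add: exp_minus field_simps)
qed

text \<open>Pairing the factors for \<open>A\<close> and \<open>- A\<close> row by row cancels the
  first-order diagonal terms, so only a loss quadratic in the entries of the row remains.\<close>

lemma det_prod_ge_exp: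
  assumes A: "small_sym_mat p (1/4) A"
  shows "exp (- 8 * frob_norm_sq p A) \<le> det (1\<^sub>m p + A) * det (1\<^sub>m p + (- A))"
proof -
  note AD = small_sym_matD[OF A]
  let ?f = "\<lambda>B i. 1 + B $$ (i, i) - 2 * (\<Sum>j<i. (B $$ (i, j))\<^sup>2) :: real"
  note mA = small_sym_mat_uminus[OF A]
  have "exp (- 8 * frob_norm_sq p A) = (\<Prod>i<p. exp (- 2 * (4 * (\<Sum>j<p. (A $$ (i, j))\<^sup>2))))"
    by (simp add: frob_norm_sq_def exp_sum[symmetric] sum_distrib_left sum_negf)
  also have "\<dots> \<le> (\<Prod>i<p. ?f A i * ?f (- A) i)"
  proof (intro prod_mono conjI)
    fix i assume "i \<in> {..<p}"
    then have i: "i < p" by simp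
    define R where "R = (\<Sum>j<p. (A $$ (i, j))\<^sup>2)"
    define q where "q = (\<Sum>j<i. (A $$ (i, j))\<^sup>2)"
    have "R \<le> (\<Sum>j<p. (1/4) * \<bar>A $$ (i, j)\<bar>)" unfolding R_def
    proof (rule sum_mono)
      fix j assume "j \<in> {..<p}"
      then have "\<bar>A $$ (i, j)\<bar> \<le> (\<Sum>j<p. \<bar>A $$ (i, j)\<bar>)"
        by (intro member_le_sum) auto
      then have "\<bar>A $$ (i, j)\<bar> \<le> 1/4" using AD(3)[OF i] by simp
      then have "\<bar>A $$ (i, j)\<bar> * \<bar>A $$ (i, j)\<bar> \<le> (1/4) * \<bar>A $$ (i, j)\<bar>"
        by (intro mult_right_mono) auto
      then show "(A $$ (i, j))\<^sup>2 \<le> (1/4) * \<bar>A $$ (i, j)\<bar>" by (simp add: power2_eq_square)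
    qed
    also have "\<dots> \<le> 1/4 * (1/4)"
      unfolding sum_distrib_left[symmetric] by (intro mult_left_mono AD(3) i) simp
    \<comment> \<open>Small enough to apply \<open>exp_le_one_minus\<close> at
      \<open>4 * R\<close>.\<close>
    finally have R: "R \<le> 1/16" by simp
    have R0: "R \<ge> 0" by (simp add: R_def sum_nonneg)
    have "q + (A $$ (i, i))\<^sup>2 = (\<Sum>j<Suc i. (A $$ (i, j))\<^sup>2)" by (simp add: q_def)
    also have "\<dots> \<le> R" unfolding R_def using i by (intro sum_mono2) auto
    finally have q: "q + (A $$ (i, i))\<^sup>2 \<le> R" .
    have "(\<Sum>j<i. ((- A) $$ (i, j))\<^sup>2) = q"
      unfolding q_def using i AD(1) by (intro sum.cong refl) auto
    then have "?f A i * ?f (- A) i = (1 + A $$ (i, i) - 2 * q) * (1 - A $$ (i, i) - 2 * q)"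
      using i AD(1) by (simp add: q_def)
    also have "\<dots> = 1 - 4 * q + 4 * q\<^sup>2 - (A $$ (i, i))\<^sup>2"
      by (simp add: power2_eq_square algebra_simps)
    finally have eq: "?f A i * ?f (- A) i = \<dots>" .
    have "exp (- 2 * (4 * R)) \<le> 1 - 4 * R" by (rule exp_le_one_minus) (use R R0 in auto)
    \<comment> \<open>Drop \<open>4 * q\<^sup>2\<close>, enlarge the squared diagonal entry to four
      times itself, and use \<open>q\<close> plus that square \<open>\<le> R\<close>.\<close>
    also have "\<dots> \<le> ?f A i * ?f (- A) i" unfolding eq using q zero_le_power2[of q] zero_le_power2[of "A $$ (i,i)"] by linarith
    finally show "exp (- 2 * (4 * (\<Sum>j<p. (A $$ (i, j))\<^sup>2))) \<le> ?f A i * ?f (- A) i"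
      by (simp add: R_def)
  qed simp
  also have "\<dots> = (\<Prod>i<p. ?f A i) * (\<Prod>i<p. ?f (- A) i)" by (simp add: prod.distrib)
  also have "\<dots> \<le> det (1\<^sub>m p + A) * det (1\<^sub>m p + (- A))"
  proof (intro mult_mono det_one_plus_ge(1) prod_nonneg A mA)
    show "0 \<le> det (1\<^sub>m p + A)" using gaussian_integral[OF pos_def_one_plus[OF A]] by simp
  qed (use det_one_plus_ge(2)[OF mA] in auto)
  finally show ?thesis .
qed

section \<open>Gaussian densities and the second moment of the likelihood ratio\<close>

lemma pos_def_inverse:
  assumes S: "pos_def_mat p S"
  obtains B where "mat_inverse S = Some B" "B \<in> carrier_mat p p" "S * B = 1\<^sub>m p" "B * S = 1\<^sub>m p"
    "\<And>i j. i < p \<Longrightarrow> j < p \<Longrightarrow> B $$ (i, j) = B $$ (j, i)"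
    "det B = 1 / det S"
proof -
  have Sc: "S \<in> carrier_mat p p" and St: "transpose_mat S = S"
    using S by (auto simp: pos_def_mat_def)
  have d: "det S > 0" using gaussian_integral[OF S] by simp
  have "S \<in> Units (ring_mat TYPE(real) p p)"
    by (rule det_non_zero_imp_unit[OF Sc]) (use d in simp)
  then obtain B where Bi: "mat_inverse S = Some B"
    using mat_inverse(1)[OF Sc, where b = p] by (cases "mat_inverse S") auto
  note B = mat_inverse(2)[OF Sc Bi]
  have "transpose_mat B * S = 1\<^sub>m p"
    using B Sc St transpose_mult[of S p p B p] by simp
  then have "transpose_mat B * S * B = B" using left_mult_one_mat[of B p p] B by simp
  then have tB: "transpose_mat B = B"
    using B Sc by (metis assoc_mult_mat right_mult_one_mat transpose_carrier_mat)
  have "B $$ (i, j) = B $$ (j, i)" if "i < p" "j < p" for i j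
    using tB B that by (metis carrier_matD index_transpose_mat(1))
  moreover have "det B = 1 / det S"
    using det_mult[of S p B] B Sc d by (simp add: field_simps)
  ultimately show thesis using that[OF Bi] B by blast
qed

lemma gauss_density_qform:
  assumes "mat_inverse S = Some B" "B \<in> carrier_mat p p"
  shows "gauss_density p S x = exp (- qform p B x / 2) / sqrt ((2 * pi) ^ p * det S)"
  using assms by (simp add: gauss_density_def Let_def qform_vec)

lemma qform_congruence:
  assumes S: "S \<in> carrier_mat p p" and M: "M \<in> carrier_mat p p"
    and y: "\<And>i. i < p \<Longrightarrow> x i = (\<Sum>j<p. S $$ (i, j) * y j)"
  shows "qform p M x = qform p (transpose_mat S * M * S) y"
proof -
  have e: "vec p x = S *\<^sub>v vec p y"
    using S y by (intro eq_vecI) (auto simp: scalar_prod_def lessThan_atLeast0)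
  have "qform p M x = vec p x \<bullet> (M *\<^sub>v vec p x)" using qform_vec[OF M] by simp
  also have "\<dots> = (S *\<^sub>v vec p y) \<bullet> (M *\<^sub>v (S *\<^sub>v vec p y))" by (simp only: e)
  also have "\<dots> = vec p y \<bullet> (transpose_mat S *\<^sub>v (M *\<^sub>v (S *\<^sub>v vec p y)))"
    using transpose_vec_mult_scalar[of "transpose_mat S" p p "M *\<^sub>v (S *\<^sub>v vec p y)" "vec p y"] S M by simp
  also have "\<dots> = vec p y \<bullet> ((transpose_mat S * M * S) *\<^sub>v vec p y)"
    using S M by (simp add: assoc_mult_mat_vec[of _ p p _ p])
  also have "\<dots> = qform p (transpose_mat S * M * S) y"
    by (rule qform_vec) (use S M in auto)
  finally show ?thesis .
qed

text \<open>Every vector is \<open>S\<close> applied to some \<open>y\<close>, because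
  \<open>S\<close> is invertible. The lemma serves to prove positivity of matrices built from the
  inverse of \<open>S\<close>: the congruence clears that inverse.\<close>

lemma pos_def_congruence:
  assumes S: "pos_def_mat p S" and M: "M \<in> carrier_mat p p"
    and sym: "\<And>i j. i < p \<Longrightarrow> j < p \<Longrightarrow> M $$ (i, j) = M $$ (j, i)"
    and P: "pos_def_mat p (S * M * S)"
  shows "pos_def_mat p M"
  unfolding pos_def_mat_iff_qform
proof (intro conjI allI impI)
  fix x :: "nat \<Rightarrow> real" assume x: "\<exists>i<p. x i \<noteq> 0"
  have Sc: "S \<in> carrier_mat p p" and St: "transpose_mat S = S"
    using S by (auto simp: pos_def_mat_def)
  have "det S > 0" using gaussian_integral[OF S] by simp
  then obtain y where y: "\<And>i. i < p \<Longrightarrow> (\<Sum>j<p. S $$ (i, j) * y j) = x i"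
    using det_nonzero_solve[OF Sc, of x] by auto
  have "\<exists>i<p. y i \<noteq> 0"
  proof (rule ccontr)
    assume "\<not> ?thesis"
    then have "x i = 0" if "i < p" for i using y[OF that] by simp
    with x show False by blast
  qed
  then have "qform p (S * M * S) y > 0" using P unfolding pos_def_mat_iff_qform by blast
  then show "qform p M x > 0"
    using qform_congruence[OF Sc M, of x y] y St by simp
qed (use M sym in auto)

lemma nn_integral_gauss_density:
  assumes S: "pos_def_mat p S"
  shows "(\<integral>\<^sup>+x. ennreal (gauss_density p S x) \<partial>Rp p) = 1"
proof -
  obtain B where B: "mat_inverse S = Some B" "B \<in> carrier_mat p p" "S * B = 1\<^sub>m p" "B * S = 1\<^sub>m p"
    "\<And>i j. i < p \<Longrightarrow> j < p \<Longrightarrow> B $$ (i, j) = B $$ (j, i)" "det B = 1 / det S"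
    using pos_def_inverse[OF S] by metis
  have Sc: "S \<in> carrier_mat p p" using S by (simp add: pos_def_mat_def)
  have d: "det S > 0" using gaussian_integral[OF S] by simp
  \<comment> \<open>For the inverse \<open>B\<close> the congruence gives
    \<open>S * B * S = S\<close>.\<close>
  have "pos_def_mat p B"
    by (rule pos_def_congruence[OF S]) (use B S Sc in \<open>auto\<close>)
  note G = gaussian_integral[OF this]
  define K where "K = 1 / sqrt ((2 * pi) ^ p * det S)"
  have K: "K \<ge> 0" using d by (simp add: K_def)
  have "(\<integral>\<^sup>+x. ennreal (gauss_density p S x) \<partial>Rp p) = (\<integral>\<^sup>+x. ennreal K * ennreal (exp (- qform p B x / 2)) \<partial>Rp p)"
    using d by (intro nn_integral_cong)
      (simp add: gauss_density_qform[OF B(1,2)] K_def ennreal_mult[symmetric])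
  also have "\<dots> = ennreal K * (\<integral>\<^sup>+x. ennreal (exp (- qform p B x / 2)) \<partial>Rp p)"
    by (rule nn_integral_cmult) measurable
  also have "\<dots> = ennreal (K * sqrt ((2 * pi) ^ p * det S))"
    using G K by (simp add: ennreal_mult B(6))
  also have "\<dots> = 1" using d by (simp add: K_def)
  finally show ?thesis .
qed

lemma gauss_density_pos:
  assumes S: "pos_def_mat p S"
  shows "gauss_density p S x > 0"
  using gaussian_integral[OF S] by (simp add: gauss_density_def Let_def)

lemma gauss_density_measurable:
  assumes S: "pos_def_mat p S"
  shows "gauss_density p S \<in> borel_measurable (Rp p)"
proof -
  obtain B where "mat_inverse S = Some B" "B \<in> carrier_mat p p"
    using pos_def_inverse[OF S] by metis
  then have "gauss_density p S = (\<lambda>x. exp (- qform p B x / 2) / sqrt ((2 * pi) ^ p * det S))"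
    by (intro ext gauss_density_qform)
  then show ?thesis by simp
qed

lemma small_sym_mat_mono:
  assumes "small_sym_mat p r A" "r \<le> r'"
  shows "small_sym_mat p r' A"
  using assms unfolding small_sym_mat_def by (meson order_trans)

lemma small_sym_mat_0: "r \<ge> 0 \<Longrightarrow> small_sym_mat p r (0\<^sub>m p p)"
  by (simp add: small_sym_mat_def)

text \<open>The quotient is a Gaussian kernel with precision matrix \<open>M = 2 B - I\<close>,
  where \<open>B\<close> is the inverse of \<open>I + A\<close>. As \<open>M = (I - A) B\<close>,
  its determinant is \<open>det (I - A) / det (I + A)\<close>; with the normalising constants the
  integral is the reciprocal square root of the product bounded in
  \<open>det_prod_ge_exp\<close>.\<close>

lemma gauss_chi_square:
  assumes A: "small_sym_mat p (1/4) A"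
  shows "(\<integral>\<^sup>+x. ennreal ((gauss_density p (1\<^sub>m p + A) x)\<^sup>2 / gauss_density p (1\<^sub>m p) x) \<partial>Rp p)
       \<le> ennreal (exp (4 * frob_norm_sq p A))"
proof -
  let ?S = "1\<^sub>m p + A" and ?T = "1\<^sub>m p + (- A)"
  note AD = small_sym_matD[OF A]
  have S: "pos_def_mat p ?S" by (rule pos_def_one_plus[OF A]) simp
  have T: "pos_def_mat p ?T" by (rule pos_def_one_plus[OF small_sym_mat_uminus[OF A]]) simp
  have I: "pos_def_mat p (1\<^sub>m p)"
    using pos_def_one_plus[OF small_sym_mat_0[of 0 p]] by simp
  have Sc: "?S \<in> carrier_mat p p" and Tc: "?T \<in> carrier_mat p p" using AD(1) by auto
  obtain B where B: "mat_inverse ?S = Some B" "B \<in> carrier_mat p p" "?S * B = 1\<^sub>m p" "B * ?S = 1\<^sub>m p"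
    "\<And>i j. i < p \<Longrightarrow> j < p \<Longrightarrow> B $$ (i, j) = B $$ (j, i)" "det B = 1 / det ?S"
    using pos_def_inverse[OF S] by metis
  obtain J where J: "mat_inverse (1\<^sub>m p :: real mat) = Some J" "J \<in> carrier_mat p p" "1\<^sub>m p * J = 1\<^sub>m p"
    using pos_def_inverse[OF I] by metis
  then have "mat_inverse (1\<^sub>m p :: real mat) = Some (1\<^sub>m p)" by simp
  from gauss_density_qform[OF this] have f0: "gauss_density p (1\<^sub>m p) x = exp (- qform p (1\<^sub>m p) x / 2) / sqrt ((2 * pi) ^ p)" for x
    by simp
  define d where "d = det ?S"
  have d: "d > 0" using gaussian_integral[OF S] by (simp add: d_def)
  define dT where "dT = det ?T"
  have dT: "dT > 0" using gaussian_integral[OF T] by (simp add: dT_def)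
  define M where "M = 2 \<cdot>\<^sub>m B + (- 1\<^sub>m p)"
  have Mc: "M \<in> carrier_mat p p" using B by (simp add: M_def)
  have MTB: "M = ?T * B"
  proof -
    have "B + A * B = 1\<^sub>m p"
      using B AD(1) add_mult_distrib_mat[of "1\<^sub>m p" p p A B p] by simp
    then have ent: "B $$ (i, j) + (A * B) $$ (i, j) = (1\<^sub>m p) $$ (i, j)" if "i < p" "j < p" for i j
      using that B AD(1) by (metis carrier_matD index_add_mat(1) mult_carrier_mat)
    have "?T * B = B + (- A) * B"
      using B AD(1) add_mult_distrib_mat[of "1\<^sub>m p" p p "- A" B p] by simp
    also have "\<dots> = B + - (A * B)" using B AD(1) by simp
    also have "\<dots> = M"
    proof (rule eq_matI)
      fix i j assume "i < dim_row M" "j < dim_col M"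
      then have ij: "i < p" "j < p" using Mc by auto
      then show "(B + - (A * B)) $$ (i, j) = M $$ (i, j)"
        using ent[OF ij] B(2) AD(1) by (simp add: M_def)
    qed (use Mc B AD(1) in auto)
    finally show ?thesis by simp
  qed
  have detM: "det M = dT / d"
    unfolding MTB using det_mult[OF Tc B(2)] B(6) by (simp add: d_def dT_def)
  \<comment> \<open>Congruence by \<open>?S\<close> gives \<open>?S * ?T\<close>, that is
    \<open>I - A * A\<close>, and the row sums of \<open>A * A\<close> are at most 1/16.\<close>
  have Mpd: "pos_def_mat p M"
  proof (rule pos_def_congruence[OF S Mc])
    show "M $$ (i, j) = M $$ (j, i)" if "i < p" "j < p" for i j
      using that B(2,5) by (auto simp: M_def)
    have "?S * M * ?S = ?S * (?T * B) * ?S" by (simp add: MTB)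
    also have "\<dots> = ?S * ?T * (B * ?S)"
      using Sc Tc B(2) by (simp add: assoc_mult_mat[of _ p p _ p _ p])
    also have "\<dots> = ?S * ?T" by (simp only: B(4) right_mult_one_mat[OF mult_carrier_mat[OF Sc Tc]])
    also have "\<dots> = 1\<^sub>m p + - (A * A)"
    proof -
      have "?S * ?T = ?T + A * ?T"
        using add_mult_distrib_mat[of "1\<^sub>m p" p p A ?T p] Tc AD(1) by simp
      also have "A * ?T = A + - (A * A)"
        using mult_add_distrib_mat[of A p p "1\<^sub>m p" p "- A"] AD(1) by simp
      also have "?T + (A + - (A * A)) = 1\<^sub>m p + - (A * A)"
        using AD(1) by (intro eq_matI) (auto simp del: index_mult_mat(1))
      finally show ?thesis .
    qed
    finally have e: "?S * M * ?S = 1\<^sub>m p + - (A * A)" .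
    show "pos_def_mat p (?S * M * ?S)"
      unfolding e by (rule pos_def_one_plus[OF small_sym_mat_uminus[OF small_sym_mat_square[OF A]]])
        (auto simp: power2_eq_square)
  qed
  note G = gaussian_integral[OF Mpd]
  define K where "K = 1 / (sqrt ((2 * pi) ^ p) * d)"
  have K: "K \<ge> 0" using d by (simp add: K_def)
  have eq: "(gauss_density p ?S x)\<^sup>2 / gauss_density p (1\<^sub>m p) x = K * exp (- qform p M x / 2)" for x
  proof -
    have "qform p M x = 2 * qform p B x - qform p (1\<^sub>m p) x"
    proof -
      have "- 1\<^sub>m p = (- 1) \<cdot>\<^sub>m (1\<^sub>m p :: real mat)" by (intro eq_matI) auto
      then have "qform p (- 1\<^sub>m p) x = - qform p (1\<^sub>m p) x"
        using qform_smult[of "1\<^sub>m p" p "- 1" x] by simp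
      then show ?thesis
        unfolding M_def using B(2) by (simp add: qform_add[of _ p] qform_smult[of _ p])
    qed
    then have e: "exp (- qform p M x / 2) = (exp (- qform p B x / 2))\<^sup>2 / exp (- qform p (1\<^sub>m p) x / 2)"
      by (simp add: power2_eq_square exp_add[symmetric] exp_diff[symmetric] field_simps)
    have "sqrt ((2 * pi) ^ p) > 0" by simp
    moreover have "(sqrt ((2 * pi) ^ p * d))\<^sup>2 = (sqrt ((2 * pi) ^ p))\<^sup>2 * d"
      using d by simp
    ultimately show ?thesis
      unfolding gauss_density_qform[OF B(1,2)] f0 e K_def d_def[symmetric] power_divide
      using d by (simp add: field_simps power2_eq_square)
  qed
  have "(\<integral>\<^sup>+x. ennreal ((gauss_density p ?S x)\<^sup>2 / gauss_density p (1\<^sub>m p) x) \<partial>Rp p)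
     = (\<integral>\<^sup>+x. ennreal K * ennreal (exp (- qform p M x / 2)) \<partial>Rp p)"
    using K by (simp add: eq ennreal_mult)
  also have "\<dots> = ennreal K * (\<integral>\<^sup>+x. ennreal (exp (- qform p M x / 2)) \<partial>Rp p)"
    by (rule nn_integral_cmult) measurable
  also have "\<dots> = ennreal (K * sqrt ((2 * pi) ^ p / (dT / d)))"
    unfolding conjunct2[OF G] detM using K d dT by (subst ennreal_mult) auto
  also have "K * sqrt ((2 * pi) ^ p / (dT / d)) = 1 / sqrt (d * dT)"
  proof -
    have "sqrt ((2 * pi) ^ p / (dT / d)) = sqrt ((2 * pi) ^ p) * (sqrt d / sqrt dT)"
      by (simp add: real_sqrt_mult real_sqrt_divide)
    moreover have "sqrt d / d = 1 / sqrt d" using d by (simp add: real_div_sqrt field_simps)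
    ultimately have "K * sqrt ((2 * pi) ^ p / (dT / d)) = (sqrt d / d) / sqrt dT"
      unfolding K_def by simp
    then show ?thesis using \<open>sqrt d / d = 1 / sqrt d\<close> by (simp add: real_sqrt_mult)
  qed
  also have "1 / sqrt (d * dT) \<le> exp (4 * frob_norm_sq p A)"
  proof -
    have "exp (- 4 * frob_norm_sq p A) = sqrt (exp (- 8 * frob_norm_sq p A))"
      by (rule real_sqrt_unique[symmetric]) (auto simp: power2_eq_square exp_add[symmetric])
    also have "\<dots> \<le> sqrt (d * dT)"
      using det_prod_ge_exp[OF A] by (simp add: d_def dT_def)
    finally show ?thesis using d dT by (simp add: exp_minus field_simps)
  qed
  finally show ?thesis using ennreal_leI by blast
qed

section \<open>Eigenvalues and membership in \<open>U_class\<close>\<close>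

lemma finite_eigenvalues:
  assumes "(A :: real mat) \<in> carrier_mat p p"
  shows "finite {k. eigenvalue A k}"
proof -
  have "char_poly A \<noteq> 0"
    using degree_monic_char_poly[OF assms] by auto
  then show ?thesis
    using poly_roots_finite[of "char_poly A"] by (simp add: eigenvalue_root_char_poly[OF assms])
qed

text \<open>The quadratic form at an eigenvector confines every eigenvalue to
  \<open>[1 - r, 1 + r]\<close>. The uncoupled index \<open>i0\<close> exhibits one eigenvalue, so
  that \<open>Min\<close> and \<open>Max\<close> range over a nonempty set and are attained.\<close>

lemma U_class_one_plus:
  assumes A: "small_sym_mat p r A" and r: "r < 1" "1 + r \<le> \<tau>" "1 / \<tau> \<le> 1 - r"
    and i0: "i0 < p" "\<And>j. j < p \<Longrightarrow> j \<noteq> i0 \<Longrightarrow> A $$ (i0, j) = 0"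
    and s: "card {(i, j). i < p \<and> j < p \<and> i \<noteq> j \<and> A $$ (i, j) \<noteq> 0} \<le> s0"
  shows "1\<^sub>m p + A \<in> U_class p s0 \<tau>"
proof -
  let ?S = "1\<^sub>m p + A"
  note AD = small_sym_matD[OF A]
  have Sc: "?S \<in> carrier_mat p p" using AD(1) by simp
  have fin: "finite {k. eigenvalue ?S k}" by (rule finite_eigenvalues[OF Sc])
  have bd: "1 - r \<le> k \<and> k \<le> 1 + r" if k: "eigenvalue ?S k" for k
  proof -
    from k obtain v where v: "v \<in> carrier_vec p" "v \<noteq> 0\<^sub>v p" "?S *\<^sub>v v = k \<cdot>\<^sub>v v"
      using Sc by (auto simp: eigenvalue_def eigenvector_def)
    define x where "x = (\<lambda>i. v $ i)"
    have vx: "v = vec p x" using v(1) by (intro eq_vecI) (auto simp: x_def)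
    have "\<exists>i<p. x i \<noteq> 0"
    proof (rule ccontr)
      assume "\<not> ?thesis"
      then have "v = 0\<^sub>v p" using v(1) by (intro eq_vecI) (auto simp: x_def)
      with v show False by simp
    qed
    then have pos: "(\<Sum>i<p. (x i)\<^sup>2) > 0" by (auto intro!: sum_pos2)
    have "qform p ?S x = v \<bullet> (?S *\<^sub>v v)" using qform_vec[OF Sc, of x] vx by simp
    also have "\<dots> = k * (\<Sum>i<p. (x i)\<^sup>2)"
      unfolding v(3) unfolding vx
      by (simp add: scalar_prod_def lessThan_atLeast0 power2_eq_square sum_distrib_left mult_ac)
    finally have e: "qform p ?S x = k * (\<Sum>i<p. (x i)\<^sup>2)" .
    have "qform p ?S x = (\<Sum>i<p. (x i)\<^sup>2) + qform p A x"
      using AD(1) by (simp add: qform_add[of _ p] qform_one)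
    then have "\<bar>(k - 1) * (\<Sum>i<p. (x i)\<^sup>2)\<bar> \<le> r * (\<Sum>i<p. (x i)\<^sup>2)"
      using abs_qform_le[OF A, of x] e by (simp add: algebra_simps)
    then have "\<bar>k - 1\<bar> \<le> r" using pos by (simp add: abs_mult)
    then show ?thesis by linarith
  qed
  have "eigenvalue ?S (1 + A $$ (i0, i0))"
  proof -
    have "?S *\<^sub>v unit_vec p i0 = (1 + A $$ (i0, i0)) \<cdot>\<^sub>v unit_vec p i0"
    proof (rule eq_vecI)
      fix i assume "i < dim_vec ((1 + A $$ (i0, i0)) \<cdot>\<^sub>v unit_vec p i0)"
      then have i: "i < p" by simp
      have "(?S *\<^sub>v unit_vec p i0) $ i = row ?S i \<bullet> unit_vec p i0"
        using i AD(1) by (intro index_mult_mat_vec) simp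
      also have "\<dots> = row ?S i $ i0"
        by (rule scalar_prod_right_unit[OF i0(1)])
      also have "\<dots> = ?S $$ (i, i0)" using i i0 AD(1) by simp
      also have "\<dots> = (if i = i0 then 1 else 0) + A $$ (i0, i)"
        using i i0 AD(1) AD(2)[of i i0] by simp
      finally show "(?S *\<^sub>v unit_vec p i0) $ i = ((1 + A $$ (i0, i0)) \<cdot>\<^sub>v unit_vec p i0) $ i"
        using i i0 by simp
    qed (use AD(1) in simp)
    moreover have "unit_vec p i0 \<noteq> (0\<^sub>v p :: real vec)"
      using i0(1) by (metis index_unit_vec(1) index_zero_vec(1) zero_neq_one)
    ultimately show ?thesis
      unfolding eigenvalue_def eigenvector_def using AD(1) by (intro exI[of _ "unit_vec p i0"]) simp
  qed
  then have ne: "{k. eigenvalue ?S k} \<noteq> {}" by blast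
  have mn: "Min {k. eigenvalue ?S k} \<in> {k. eigenvalue ?S k}" by (rule Min_in[OF fin ne])
  have mx: "Max {k. eigenvalue ?S k} \<in> {k. eigenvalue ?S k}" by (rule Max_in[OF fin ne])
  have "lambda_min ?S \<le> lambda_max ?S"
    unfolding lambda_min_def lambda_max_def using fin mn by (intro Max_ge) auto
  moreover have "1 / \<tau> \<le> lambda_min ?S" using mn bd r unfolding lambda_min_def by fastforce
  moreover have "lambda_max ?S \<le> \<tau>" using mx bd r unfolding lambda_max_def by fastforce
  moreover have "offdiag_support p ?S \<le> s0"
  proof -
    have "{(i, j). i < p \<and> j < p \<and> i \<noteq> j \<and> ?S $$ (i, j) \<noteq> 0} = {(i, j). i < p \<and> j < p \<and> i \<noteq> j \<and> A $$ (i, j) \<noteq> 0}"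
      using AD(1) by auto
    then show ?thesis using s by (simp add: offdiag_support_def)
  qed
  ultimately show ?thesis
    using pos_def_one_plus[OF A r(1)] by (simp add: U_class_def)
qed

section \<open>Lower bounds from packings\<close>

lemma PiM_density:
  assumes I: "finite I" and M: "sigma_finite_measure M" and f [measurable]: "f \<in> borel_measurable M"
    and D: "sigma_finite_measure (density M f)"
  shows "PiM I (\<lambda>_. density M f) = density (PiM I (\<lambda>_. M)) (\<lambda>x. \<Prod>i\<in>I. f (x i))"
proof -
  interpret D: product_sigma_finite "\<lambda>_. density M f" using D by (simp add: product_sigma_finite_def)
  interpret M: product_sigma_finite "\<lambda>_. M" using M by (simp add: product_sigma_finite_def)
  have "density (PiM I (\<lambda>_. M)) (\<lambda>x. \<Prod>i\<in>I. f (x i)) = PiM I (\<lambda>_. density M f)"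
  proof (rule D.PiM_eqI[OF I])
    show "sets (density (PiM I (\<lambda>_. M)) (\<lambda>x. \<Prod>i\<in>I. f (x i))) = sets (PiM I (\<lambda>_. density M f))"
      by (simp cong: sets_PiM_cong)
    fix A assume A: "\<And>i. i \<in> I \<Longrightarrow> A i \<in> sets (density M f)"
    then have A': "\<And>i. i \<in> I \<Longrightarrow> A i \<in> sets M" by simp
    have "emeasure (density (PiM I (\<lambda>_. M)) (\<lambda>x. \<Prod>i\<in>I. f (x i))) (Pi\<^sub>E I A)
        = (\<integral>\<^sup>+x. (\<Prod>i\<in>I. f (x i)) * indicator (Pi\<^sub>E I A) x \<partial>PiM I (\<lambda>_. M))"
      by (rule emeasure_density) (use I A' in \<open>auto intro!: sets_PiM_I_finite\<close>)
    also have "\<dots> = (\<integral>\<^sup>+x. (\<Prod>i\<in>I. f (x i) * indicator (A i) (x i)) \<partial>PiM I (\<lambda>_. M))"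
    proof (rule nn_integral_cong)
      fix x assume x: "x \<in> space (PiM I (\<lambda>_. M))"
      then have "indicator (Pi\<^sub>E I A) x = (\<Prod>i\<in>I. indicator (A i) (x i) :: ennreal)"
        using I by (auto simp: indicator_def space_PiM PiE_iff prod_zero_iff intro!: prod.neutral)
      then show "(\<Prod>i\<in>I. f (x i)) * indicator (Pi\<^sub>E I A) x = (\<Prod>i\<in>I. f (x i) * indicator (A i) (x i))"
        by (simp add: prod.distrib)
    qed
    also have "\<dots> = (\<Prod>i\<in>I. \<integral>\<^sup>+x. f x * indicator (A i) x \<partial>M)"
      by (rule M.product_nn_integral_prod) (use I A' in auto)
    also have "\<dots> = (\<Prod>i\<in>I. emeasure (density M f) (A i))"
      using A' by (intro prod.cong refl emeasure_density[symmetric]) auto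
    finally show "emeasure (density (PiM I (\<lambda>_. M)) (\<lambda>x. \<Prod>i\<in>I. f (x i))) (Pi\<^sub>E I A)
        = (\<Prod>i\<in>I. emeasure (density M f) (A i))" .
  qed
  then show ?thesis by simp
qed

lemma sigma_finite_Rp: "sigma_finite_measure (Rp p)"
  unfolding Rp_def
  by (rule product_sigma_finite.sigma_finite[OF product_sigma_finite_lborel]) simp

lemma prob_space_gaussian:
  assumes "pos_def_mat p S"
  shows "prob_space (gaussian p S)"
proof
  show "emeasure (gaussian p S) (space (gaussian p S)) = 1"
    unfolding gaussian_def
    using nn_integral_gauss_density[OF assms] gauss_density_measurable[OF assms]
    by (subst emeasure_density) (auto simp: cong: nn_integral_cong)
qed

lemma prob_space_sample_measure:
  assumes "pos_def_mat p S"
  shows "prob_space (sample_measure n p S)"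
  unfolding sample_measure_def by (rule prob_space_PiM) (rule prob_space_gaussian[OF assms])

lemma sample_measure_density:
  assumes "pos_def_mat p S"
  shows "sample_measure n p S = density (PiM {..<n} (\<lambda>_. Rp p)) (\<lambda>X. ennreal (\<Prod>k<n. gauss_density p S (X k)))"
proof -
  have "sigma_finite_measure (gaussian p S)"
    using prob_space_gaussian[OF assms] prob_space_imp_sigma_finite by blast
  then have "sample_measure n p S = density (PiM {..<n} (\<lambda>_. Rp p)) (\<lambda>X. \<Prod>k<n. ennreal (gauss_density p S (X k)))"
    unfolding sample_measure_def gaussian_def
    by (intro PiM_density sigma_finite_Rp) (use gauss_density_measurable[OF assms] in auto)
  then show ?thesis
    using gauss_density_pos[OF assms] by (simp add: prod_ennreal less_imp_le)
qed

lemma sets_sample_measure: "sets (sample_measure n p S) = sets (PiM {..<n} (\<lambda>_. Rp p))"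
  unfolding sample_measure_def gaussian_def by (intro sets_PiM_cong) auto

text \<open>Second moments of likelihood ratios multiply over independent observations, which puts
  the factor \<open>n\<close> into the exponent.\<close>

lemma sample_chi_square:
  assumes A: "small_sym_mat p (1/4) A"
  shows "(\<integral>\<^sup>+X. ennreal ((\<Prod>k<n. gauss_density p (1\<^sub>m p + A) (X k))\<^sup>2 / (\<Prod>k<n. gauss_density p (1\<^sub>m p) (X k)))
            \<partial>PiM {..<n} (\<lambda>_. Rp p)) \<le> ennreal (exp (4 * real n * frob_norm_sq p A))"
proof -
  interpret product_sigma_finite "\<lambda>_::nat. Rp p"
    using sigma_finite_Rp by (simp add: product_sigma_finite_def)
  have S: "pos_def_mat p (1\<^sub>m p + A)" by (rule pos_def_one_plus[OF A]) simp
  have I: "pos_def_mat p (1\<^sub>m p)"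
    using pos_def_one_plus[OF small_sym_mat_0[of 0 p]] by simp
  note [measurable] = gauss_density_measurable[OF S] gauss_density_measurable[OF I]
  let ?g = "\<lambda>x. (gauss_density p (1\<^sub>m p + A) x)\<^sup>2 / gauss_density p (1\<^sub>m p) x"
  have g0: "?g x \<ge> 0" for x using gauss_density_pos[OF I, of x] by simp
  have "(\<integral>\<^sup>+X. ennreal ((\<Prod>k<n. gauss_density p (1\<^sub>m p + A) (X k))\<^sup>2 / (\<Prod>k<n. gauss_density p (1\<^sub>m p) (X k)))
            \<partial>PiM {..<n} (\<lambda>_. Rp p)) = (\<integral>\<^sup>+X. (\<Prod>k<n. ennreal (?g (X k))) \<partial>PiM {..<n} (\<lambda>_. Rp p))"
    using g0 by (simp add: prod_ennreal prod_dividef prod_power_distrib)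
  also have "\<dots> = (\<Prod>k<n. \<integral>\<^sup>+x. ennreal (?g x) \<partial>Rp p)"
    by (rule product_nn_integral_prod) auto
  also have "\<dots> \<le> (\<Prod>k<n. ennreal (exp (4 * frob_norm_sq p A)))"
    by (intro prod_mono_ennreal gauss_chi_square[OF A])
  also have "\<dots> = ennreal (exp (4 * real n * frob_norm_sq p A))"
    by (simp add: ennreal_power exp_of_nat_mult[symmetric] mult_ac)
  finally show ?thesis .
qed

text \<open>A change of measure to the common reference \<open>I\<close>. One part of the bound is
  proportional to the reference probability, and so can be summed over disjoint events; the other
  does not depend on \<open>G\<close>. The free weight \<open>c\<close> balances the two.\<close>

lemma sample_prob_le:
  assumes A: "small_sym_mat p (1/4) A" and G: "G \<in> sets (PiM {..<n} (\<lambda>_. Rp p))" and c: "c > 0"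
  shows "measure (sample_measure n p (1\<^sub>m p + A)) G
    \<le> c / 2 * measure (sample_measure n p (1\<^sub>m p)) G + exp (4 * real n * frob_norm_sq p A) / (2 * c)"
proof -
  let ?mu = "PiM {..<n} (\<lambda>_. Rp p)"
  have S: "pos_def_mat p (1\<^sub>m p + A)" by (rule pos_def_one_plus[OF A]) simp
  have I: "pos_def_mat p (1\<^sub>m p)"
    using pos_def_one_plus[OF small_sym_mat_0[of 0 p]] by simp
  note [measurable] = gauss_density_measurable[OF S] gauss_density_measurable[OF I] G
  interpret P: prob_space "sample_measure n p (1\<^sub>m p + A)" by (rule prob_space_sample_measure[OF S])
  interpret Q: prob_space "sample_measure n p (1\<^sub>m p)" by (rule prob_space_sample_measure[OF I])
  define l where "l X = (\<Prod>k<n. gauss_density p (1\<^sub>m p + A) (X k))" for X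
  define l0 where "l0 X = (\<Prod>k<n. gauss_density p (1\<^sub>m p) (X k))" for X
  have lpos: "l X > 0" "l0 X > 0" for X
    unfolding l_def l0_def by (auto intro!: prod_pos gauss_density_pos S I)
  have [measurable]: "l \<in> borel_measurable ?mu" "l0 \<in> borel_measurable ?mu"
    unfolding l_def l0_def by measurable
  have "emeasure (sample_measure n p (1\<^sub>m p + A)) G = (\<integral>\<^sup>+X. ennreal (l X) * indicator G X \<partial>?mu)"
    unfolding sample_measure_density[OF S] l_def[symmetric] by (rule emeasure_density) auto
  also have "\<dots> \<le> (\<integral>\<^sup>+X. ennreal (c / 2) * (ennreal (l0 X) * indicator G X)
        + ennreal (1 / (2 * c)) * ennreal ((l X)\<^sup>2 / l0 X) \<partial>?mu)"
  proof (rule nn_integral_mono) \<comment> \<open>AM-GM with weight \<open>c\<close>, in place of Cauchy--Schwarz\<close>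
    fix X
    have "0 \<le> (l X - c * l0 X)\<^sup>2 / (2 * c * l0 X)" using c lpos(2)[of X] by simp
    also have "\<dots> = c / 2 * l0 X + 1 / (2 * c) * ((l X)\<^sup>2 / l0 X) - l X"
      using c lpos(2)[of X] by (simp add: power2_eq_square field_simps)
    finally have "l X \<le> c / 2 * l0 X + 1 / (2 * c) * ((l X)\<^sup>2 / l0 X)" by simp
    then have "ennreal (l X) \<le> ennreal (c / 2 * l0 X + 1 / (2 * c) * ((l X)\<^sup>2 / l0 X))"
      by (rule ennreal_leI)
    also have "\<dots> = ennreal (c / 2) * ennreal (l0 X) + ennreal (1 / (2 * c)) * ennreal ((l X)\<^sup>2 / l0 X)"
      using c lpos(2)[of X] by (simp add: ennreal_plus ennreal_mult[symmetric])
    finally show "ennreal (l X) * indicator G X \<le> ennreal (c / 2) * (ennreal (l0 X) * indicator G X)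
        + ennreal (1 / (2 * c)) * ennreal ((l X)\<^sup>2 / l0 X)"
      by (auto simp: indicator_def)
  qed
  also have "\<dots> = ennreal (c / 2) * (\<integral>\<^sup>+X. ennreal (l0 X) * indicator G X \<partial>?mu)
        + ennreal (1 / (2 * c)) * (\<integral>\<^sup>+X. ennreal ((l X)\<^sup>2 / l0 X) \<partial>?mu)"
    by (subst nn_integral_add) (auto simp: nn_integral_cmult)
  also have "(\<integral>\<^sup>+X. ennreal (l0 X) * indicator G X \<partial>?mu) = emeasure (sample_measure n p (1\<^sub>m p)) G"
    unfolding sample_measure_density[OF I] l0_def[symmetric] by (rule emeasure_density[symmetric]) auto
  also have "(\<integral>\<^sup>+X. ennreal ((l X)\<^sup>2 / l0 X) \<partial>?mu) \<le> ennreal (exp (4 * real n * frob_norm_sq p A))"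
    unfolding l_def l0_def by (rule sample_chi_square[OF A])
  finally have "ennreal (P.prob G) \<le> ennreal (c / 2) * ennreal (Q.prob G)
      + ennreal (1 / (2 * c)) * ennreal (exp (4 * real n * frob_norm_sq p A))"
    by (simp add: P.emeasure_eq_measure Q.emeasure_eq_measure add_left_mono mult_left_mono)
  also have "\<dots> = ennreal (c / 2 * Q.prob G + 1 / (2 * c) * exp (4 * real n * frob_norm_sq p A))"
    using c by (subst ennreal_plus) (auto simp: ennreal_mult[symmetric])
  finally show ?thesis using c by (subst (asm) ennreal_le_iff) auto
qed

section \<open>From separated hypotheses to the minimax risk\<close>

lemma frob_triangle:
  fixes a b c :: "nat \<Rightarrow> nat \<Rightarrow> real"
  shows "(\<Sum>i<p. \<Sum>j<p. (a i j - b i j)\<^sup>2)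
    \<le> 2 * (\<Sum>i<p. \<Sum>j<p. (c i j - a i j)\<^sup>2) + 2 * (\<Sum>i<p. \<Sum>j<p. (c i j - b i j)\<^sup>2)"
  unfolding sum_distrib_left sum.distrib[symmetric]
proof (intro sum_mono)
  fix i j
  have "0 \<le> ((c i j - a i j) + (c i j - b i j))\<^sup>2" by simp
  then show "(a i j - b i j)\<^sup>2 \<le> 2 * (c i j - a i j)\<^sup>2 + 2 * (c i j - b i j)\<^sup>2"
    by (simp add: power2_eq_square algebra_simps)
qed

text \<open>The events \<open>G A\<close>, that the estimate lies within squared distance
  \<open>d\<close> of hypothesis \<open>A\<close>, are disjoint, so their probabilities under
  \<open>I\<close> sum to at most 1. Hence some hypothesis has probability at least 1/2 of missing
  its own event, and on a miss the loss is at least \<open>d\<close>.\<close>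

lemma minimax_risk_ge_packing:
  assumes fin: "finite \<A>" and ne: "\<A> \<noteq> {}"
    and A: "\<And>A. A \<in> \<A> \<Longrightarrow> small_sym_mat p (1/4) A"
    and U: "\<And>A. A \<in> \<A> \<Longrightarrow> 1\<^sub>m p + A \<in> U_class p s0 \<tau>"
    and chi: "\<And>A. A \<in> \<A> \<Longrightarrow> exp (4 * real n * frob_norm_sq p A) \<le> real (card \<A>) / 4"
    and sep: "\<And>A B. A \<in> \<A> \<Longrightarrow> B \<in> \<A> \<Longrightarrow> A \<noteq> B \<Longrightarrow> (\<Sum>i<p. \<Sum>j<p. (A $$ (i, j) - B $$ (i, j))\<^sup>2) \<ge> 4 * d"
    and d: "d > 0"
  shows "ennreal (d / 2) \<le> minimax_risk n p s0 \<tau>"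
  unfolding minimax_risk_def
proof (rule INF_greatest)
  fix E assume E: "E \<in> estimators n p"
  let ?mu = "PiM {..<n} (\<lambda>_. Rp p)"
  let ?P = "\<lambda>A. sample_measure n p (1\<^sub>m p + A)"
  define m where "m = real (card \<A>)"
  have m: "m > 0" using fin ne by (simp add: m_def card_gt_0_iff)
  have [measurable]: "(\<lambda>X. E X i j) \<in> borel_measurable ?mu" for i j
    using E by (simp add: estimators_def)
  have [measurable]: "(\<lambda>X. frob_sq p (E X) S) \<in> borel_measurable ?mu" for S
    unfolding frob_sq_def by measurable
  define G where "G A = {X \<in> space ?mu. frob_sq p (E X) (1\<^sub>m p + A) < d}" for A
  have G [measurable]: "G A \<in> sets ?mu" for A unfolding G_def by measurable
  have I: "pos_def_mat p (1\<^sub>m p)"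
    using pos_def_one_plus[OF small_sym_mat_0[of 0 p]] by simp
  interpret Q: prob_space "sample_measure n p (1\<^sub>m p)" by (rule prob_space_sample_measure[OF I])
  have disj: "disjoint_family_on G \<A>"
    unfolding disjoint_family_on_def
  proof (intro ballI impI, rule ccontr)
    fix A B assume AB: "A \<in> \<A>" "B \<in> \<A>" "A \<noteq> B" and "G A \<inter> G B \<noteq> {}"
    then obtain X where X: "frob_sq p (E X) (1\<^sub>m p + A) < d" "frob_sq p (E X) (1\<^sub>m p + B) < d"
      by (auto simp: G_def)
    have "4 * d \<le> (\<Sum>i<p. \<Sum>j<p. (A $$ (i, j) - B $$ (i, j))\<^sup>2)" by (rule sep[OF AB])
    also have "\<dots> = (\<Sum>i<p. \<Sum>j<p. ((1\<^sub>m p + A) $$ (i, j) - (1\<^sub>m p + B) $$ (i, j))\<^sup>2)"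
      using small_sym_matD(1)[OF A[OF AB(1)]] small_sym_matD(1)[OF A[OF AB(2)]]
      by (intro sum.cong refl) auto
    also have "\<dots> \<le> 2 * frob_sq p (E X) (1\<^sub>m p + A) + 2 * frob_sq p (E X) (1\<^sub>m p + B)"
      unfolding frob_sq_def
      by (rule frob_triangle[where a = "\<lambda>i j. (1\<^sub>m p + A) $$ (i, j)" and b = "\<lambda>i j. (1\<^sub>m p + B) $$ (i, j)"])
    finally show False using X by simp
  qed
  have "(\<Sum>A\<in>\<A>. measure (?P A) (G A)) \<le> (\<Sum>A\<in>\<A>. m / 4 * Q.prob (G A) + 1 / 4)"
  proof (rule sum_mono)
    fix A assume A': "A \<in> \<A>"
    \<comment> \<open>The weight is \<open>c = m / 2\<close> for \<open>m\<close> hypotheses: the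
      first parts add up to at most \<open>m / 4\<close> by disjointness, and \<open>chi\<close>
      makes each second part at most 1/4.\<close>
    have "measure (?P A) (G A) \<le> (m / 2) / 2 * Q.prob (G A) + exp (4 * real n * frob_norm_sq p A) / (2 * (m / 2))"
      by (rule sample_prob_le[OF A[OF A']]) (use m in auto)
    also have "exp (4 * real n * frob_norm_sq p A) / (2 * (m / 2)) \<le> 1 / 4"
      using chi[OF A'] m by (simp add: m_def field_simps)
    finally show "measure (?P A) (G A) \<le> m / 4 * Q.prob (G A) + 1 / 4" by simp
  qed
  also have "\<dots> = m / 4 * (\<Sum>A\<in>\<A>. Q.prob (G A)) + m / 4"
    by (simp add: sum.distrib sum_distrib_left m_def)
  also have "(\<Sum>A\<in>\<A>. Q.prob (G A)) = Q.prob (\<Union>A\<in>\<A>. G A)"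
    by (rule Q.finite_measure_finite_Union[symmetric])
       (use fin disj G in \<open>auto simp: sets_sample_measure\<close>)
  also have "m / 4 * Q.prob (\<Union>A\<in>\<A>. G A) + m / 4 \<le> m / 2"
  proof -
    have "m / 4 * Q.prob (\<Union>A\<in>\<A>. G A) \<le> m / 4 * 1"
      using m by (intro mult_left_mono Q.prob_le_1) auto
    then show ?thesis by simp
  qed
  finally have tot: "(\<Sum>A\<in>\<A>. measure (?P A) (G A)) \<le> m / 2" .
  obtain A0 where A0: "A0 \<in> \<A>" "measure (?P A0) (G A0) \<le> 1 / 2"
  proof (rule ccontr)
    assume "\<not> thesis"
    then have "\<And>A. A \<in> \<A> \<Longrightarrow> 1 / 2 < measure (?P A) (G A)" using that by force
    then have "(\<Sum>A\<in>\<A>. 1 / 2) < (\<Sum>A\<in>\<A>. measure (?P A) (G A))"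
      using fin ne by (intro sum_strict_mono) auto
    with tot show False by (simp add: m_def)
  qed
  have S: "pos_def_mat p (1\<^sub>m p + A0)" by (rule pos_def_one_plus[OF A[OF A0(1)]]) simp
  interpret P: prob_space "?P A0" by (rule prob_space_sample_measure[OF S])
  have sp: "space (?P A0) = space ?mu" by (rule sets_eq_imp_space_eq[OF sets_sample_measure])
  have GP: "G A0 \<in> sets (?P A0)" using G by (simp add: sets_sample_measure)
  have "ennreal (d / 2) \<le> ennreal (d * P.prob (space (?P A0) - G A0))"
    using A0(2) d by (intro ennreal_leI) (simp add: P.prob_compl[OF GP])
  also have "\<dots> = ennreal d * emeasure (?P A0) (space (?P A0) - G A0)"
    using d by (simp add: P.emeasure_eq_measure ennreal_mult)
  also have "\<dots> = (\<integral>\<^sup>+X. ennreal d * indicator (space (?P A0) - G A0) X \<partial>?P A0)"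
    using GP by (simp add: nn_integral_cmult_indicator)
  also have "\<dots> \<le> risk n p E (1\<^sub>m p + A0)"
    unfolding risk_def
    by (intro nn_integral_mono) (auto simp: indicator_def G_def sp intro!: ennreal_leI)
  also have "\<dots> \<le> (SUP S\<in>U_class p s0 \<tau>. risk n p E S)"
    by (rule SUP_upper[OF U[OF A0(1)]])
  finally show "ennreal (d / 2) \<le> (SUP S\<in>U_class p s0 \<tau>. risk n p E S)" .
qed

section \<open>Hamming codes\<close>

text \<open>A word of the ball is determined by the set \<open>T\<close> where it differs from
  \<open>f\<close> and by its letters on \<open>T\<close>. There are at most
  \<open>2 ^ card D\<close> sets \<open>T\<close>, and each admits \<open>q ^ card T\<close>
  choices, at most \<open>sqrt q ^ card D\<close>.\<close>

lemma card_hamming_ball_le: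
  fixes f :: "'d \<Rightarrow> nat"
  assumes D: "finite D" and f: "f \<in> D \<rightarrow>\<^sub>E {..<q}" and q: "q \<ge> 1"
  shows "real (card {g \<in> D \<rightarrow>\<^sub>E {..<q}. 2 * card {x \<in> D. f x \<noteq> g x} \<le> card D}) \<le> (2 * sqrt (real q)) ^ card D"
proof -
  define \<T> where "\<T> = {T. T \<subseteq> D \<and> 2 * card T \<le> card D}"
  define W where "W T = PiE D (\<lambda>x. if x \<in> T then {..<q} else {f x})" for T
  have fT: "finite \<T>" using D by (auto simp: \<T>_def)
  have fW: "finite (W T)" for T unfolding W_def using D by (intro finite_PiE) auto
  have "{g \<in> D \<rightarrow>\<^sub>E {..<q}. 2 * card {x \<in> D. f x \<noteq> g x} \<le> card D} \<subseteq> (\<Union>T\<in>\<T>. W T)"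
  proof
    fix g assume g: "g \<in> {g \<in> D \<rightarrow>\<^sub>E {..<q}. 2 * card {x \<in> D. f x \<noteq> g x} \<le> card D}"
    then have "{x \<in> D. f x \<noteq> g x} \<in> \<T>" by (auto simp: \<T>_def)
    moreover have "g \<in> W {x \<in> D. f x \<noteq> g x}"
      using g by (auto simp: W_def PiE_iff)
    ultimately show "g \<in> (\<Union>T\<in>\<T>. W T)" by blast
  qed
  then have "card {g \<in> D \<rightarrow>\<^sub>E {..<q}. 2 * card {x \<in> D. f x \<noteq> g x} \<le> card D} \<le> card (\<Union>T\<in>\<T>. W T)"
    using fT fW by (intro card_mono) auto
  also have "\<dots> \<le> (\<Sum>T\<in>\<T>. card (W T))" by (rule card_UN_le[OF fT])
  finally have "real (card {g \<in> D \<rightarrow>\<^sub>E {..<q}. 2 * card {x \<in> D. f x \<noteq> g x} \<le> card D}) \<le> (\<Sum>T\<in>\<T>. real (card (W T)))"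
    by (simp only: of_nat_sum[symmetric] of_nat_le_iff)
  also have "\<dots> \<le> (\<Sum>T\<in>\<T>. sqrt (real q) ^ card D)"
  proof (rule sum_mono)
    fix T assume T: "T \<in> \<T>"
    have "card (W T) = (\<Prod>x\<in>D. if x \<in> T then q else 1)"
      unfolding W_def using D by (subst card_PiE) (auto intro!: prod.cong)
    also have "\<dots> = q ^ card T"
      using T D by (subst prod.inter_restrict[symmetric]) (auto simp: \<T>_def Int_absorb1)
    finally have "real (card (W T)) = sqrt (real q) ^ (2 * card T)"
      by (simp add: power_mult)
    also have "\<dots> \<le> sqrt (real q) ^ card D"
      using T q by (intro power_increasing) (auto simp: \<T>_def)
    finally show "real (card (W T)) \<le> sqrt (real q) ^ card D" .
  qed
  also have "\<dots> = real (card \<T>) * sqrt (real q) ^ card D" by simp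
  also have "\<dots> \<le> 2 ^ card D * sqrt (real q) ^ card D"
  proof (rule mult_right_mono)
    have "card \<T> \<le> card (Pow D)" using D by (intro card_mono) (auto simp: \<T>_def)
    then show "real (card \<T>) \<le> 2 ^ card D" using D by (simp add: card_Pow)
  qed simp
  finally show ?thesis by (simp add: power_mult_distrib)
qed

text \<open>Gilbert's argument: the balls around the words of a maximal code cover \<open>F\<close>.
  The balls are counted among all words although the code stays inside \<open>F\<close>, so
  \<open>F\<close> may carry constraints such as the permutation property.\<close>

lemma hamming_code_exists:
  fixes F :: "('d \<Rightarrow> nat) set"
  assumes D: "finite D" and F: "F \<subseteq> D \<rightarrow>\<^sub>E {..<q}" and q: "q \<ge> 1"
  obtains C where "C \<subseteq> F" "\<And>f g. f \<in> C \<Longrightarrow> g \<in> C \<Longrightarrow> f \<noteq> g \<Longrightarrow> card D < 2 * card {x \<in> D. f x \<noteq> g x}"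
    "real (card F) \<le> real (card C) * (2 * sqrt (real q)) ^ card D"
proof -
  define \<C> where "\<C> = {C. C \<subseteq> F \<and> (\<forall>f\<in>C. \<forall>g\<in>C. f \<noteq> g \<longrightarrow> card D < 2 * card {x \<in> D. f x \<noteq> g x})}"
  have fF: "finite F" using F D by (meson finite_PiE finite_lessThan finite_subset)
  have "finite \<C>" using fF by (auto simp: \<C>_def)
  moreover have "{} \<in> \<C>" by (simp add: \<C>_def)
  ultimately obtain C where C: "C \<in> \<C>" and max: "\<And>B. B \<in> \<C> \<Longrightarrow> C \<subseteq> B \<Longrightarrow> C = B"
    using finite_has_maximal[of \<C>] by blast
  let ?B = "\<lambda>f. {g \<in> D \<rightarrow>\<^sub>E {..<q}. 2 * card {x \<in> D. f x \<noteq> g x} \<le> card D}"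
  have fC: "finite C" using C fF by (auto simp: \<C>_def intro: finite_subset)
  have fB: "finite (?B f)" for f
    using D by (auto intro: finite_subset[OF _ finite_PiE[of D "\<lambda>_. {..<q}"]])
  have "F \<subseteq> (\<Union>f\<in>C. ?B f)"
  proof
    fix g assume g: "g \<in> F"
    show "g \<in> (\<Union>f\<in>C. ?B f)"
    proof (rule ccontr)
      assume n: "g \<notin> (\<Union>f\<in>C. ?B f)"
      then have far: "card D < 2 * card {x \<in> D. f x \<noteq> g x}" if "f \<in> C" for f
        using g F that by force
      moreover have "{x \<in> D. g x \<noteq> f x} = {x \<in> D. f x \<noteq> g x}" for f by auto
      ultimately have "insert g C \<in> \<C>"
        using C g by (auto simp: \<C>_def)
      then have "g \<in> C" using max by blast
      then show False using far by fastforce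
    qed
  qed
  then have "card F \<le> card (\<Union>f\<in>C. ?B f)" using fB fC by (intro card_mono) auto
  also have "\<dots> \<le> (\<Sum>f\<in>C. card (?B f))" by (rule card_UN_le[OF fC])
  finally have "real (card F) \<le> (\<Sum>f\<in>C. real (card (?B f)))" by (simp only: of_nat_sum[symmetric] of_nat_le_iff)
  also have "\<dots> \<le> (\<Sum>f\<in>C. (2 * sqrt (real q)) ^ card D)"
    using C F by (intro sum_mono card_hamming_ball_le D q) (auto simp: \<C>_def)
  finally have "real (card F) \<le> real (card C) * (2 * sqrt (real q)) ^ card D" by simp
  then show thesis using C that by (auto simp: \<C>_def)
qed

text \<open>\<open>F_large\<close> leaves the code at least \<open>4 * K\<close> words, as the
  packing bound demands. Distinct code words differ in more than half of the positions, so the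
  squared separation is at least \<open>b * card D / 2\<close>; this is \<open>4 * d\<close> with
  \<open>d / 2 = b * card D / 16\<close>.\<close>

lemma minimax_risk_ge_code:
  fixes F :: "('d \<Rightarrow> nat) set" and \<Phi> :: "('d \<Rightarrow> nat) \<Rightarrow> real mat"
  assumes D: "finite D" "D \<noteq> {}" and F: "F \<subseteq> D \<rightarrow>\<^sub>E {..<q}" and q: "q \<ge> 1"
    and small: "\<And>f. f \<in> F \<Longrightarrow> small_sym_mat p (1/4) (\<Phi> f)"
    and U: "\<And>f. f \<in> F \<Longrightarrow> 1\<^sub>m p + \<Phi> f \<in> U_class p s0 \<tau>"
    and chi: "\<And>f. f \<in> F \<Longrightarrow> exp (4 * real n * frob_norm_sq p (\<Phi> f)) \<le> K"
    and F_large: "4 * K * (2 * sqrt (real q)) ^ card D \<le> real (card F)"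
    and K: "K > 0"
    and sep: "\<And>f g. f \<in> F \<Longrightarrow> g \<in> F \<Longrightarrow>
      b * real (card {x \<in> D. f x \<noteq> g x}) \<le> (\<Sum>i<p. \<Sum>j<p. (\<Phi> f $$ (i, j) - \<Phi> g $$ (i, j))\<^sup>2)"
    and b: "b > 0"
  shows "ennreal (b * real (card D) / 16) \<le> minimax_risk n p s0 \<tau>"
proof -
  obtain C where C: "C \<subseteq> F" "\<And>f g. f \<in> C \<Longrightarrow> g \<in> C \<Longrightarrow> f \<noteq> g \<Longrightarrow> card D < 2 * card {x \<in> D. f x \<noteq> g x}"
    "real (card F) \<le> real (card C) * (2 * sqrt (real q)) ^ card D"
    using hamming_code_exists[OF D(1) F q] by blast
  have N: "card D > 0" using D by (simp add: card_gt_0_iff)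
  have fF: "finite F" using F D by (meson finite_PiE finite_lessThan finite_subset)
  have q0: "(2 * sqrt (real q)) ^ card D > 0" using q by simp
  have "4 * K * (2 * sqrt (real q)) ^ card D \<le> real (card C) * (2 * sqrt (real q)) ^ card D"
    using F_large C(3) by linarith
  then have cC: "4 * K \<le> real (card C)" using q0 by (simp only: mult_le_cancel_right_pos)
  have sepC: "4 * (b * real (card D) / 8) \<le> (\<Sum>i<p. \<Sum>j<p. (\<Phi> f $$ (i, j) - \<Phi> g $$ (i, j))\<^sup>2)"
    if "f \<in> C" "g \<in> C" "f \<noteq> g" for f g
  proof -
    have "real (card D) \<le> 2 * real (card {x \<in> D. f x \<noteq> g x})" using C(2)[OF that] by linarith
    then have "b * real (card D) \<le> b * (2 * real (card {x \<in> D. f x \<noteq> g x}))"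
      using b by (intro mult_left_mono) auto
    then show ?thesis using sep[of f g] that C(1) by (simp add: subset_iff)
  qed
  have inj: "inj_on \<Phi> C"
  proof (rule inj_onI, rule ccontr)
    fix f g assume fg: "f \<in> C" "g \<in> C" "\<Phi> f = \<Phi> g" "f \<noteq> g"
    then have "b * real (card D) \<le> 0" using sepC[of f g] by simp
    then show False using b N by (simp add: mult_le_0_iff)
  qed
  have "ennreal (b * real (card D) / 8 / 2) \<le> minimax_risk n p s0 \<tau>"
  proof (rule minimax_risk_ge_packing[where \<A> = "\<Phi> ` C"])
    show "finite (\<Phi> ` C)" using C(1) fF by (meson finite_imageI finite_subset)
    show "\<Phi> ` C \<noteq> {}" using cC K by auto
    show "0 < b * real (card D) / 8" using b N by simp
    fix A assume "A \<in> \<Phi> ` C"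
    then obtain f where f: "f \<in> C" "A = \<Phi> f" by auto
    then have fF': "f \<in> F" using C(1) by auto
    show "small_sym_mat p (1/4) A" "1\<^sub>m p + A \<in> U_class p s0 \<tau>"
      using small[OF fF'] U[OF fF'] f(2) by auto
    show "exp (4 * real n * frob_norm_sq p A) \<le> real (card (\<Phi> ` C)) / 4"
      using chi[OF fF'] cC f(2) by (simp add: card_image[OF inj])
  next
    fix A B assume "A \<in> \<Phi> ` C" "B \<in> \<Phi> ` C" "A \<noteq> B"
    then show "4 * (b * real (card D) / 8) \<le> (\<Sum>i<p. \<Sum>j<p. (A $$ (i, j) - B $$ (i, j))\<^sup>2)"
      using sepC by auto
  qed
  then show ?thesis by simp
qed

section \<open>The rate p / n from diagonal hypotheses\<close>

lemma minimax_risk_ge_diag: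
  assumes p: "p \<ge> 1" and n: "n \<ge> 1" and r: "r \<le> 1/4" "1 + r \<le> \<tau>" "1 / \<tau> \<le> 1 - r"
    and nr: "1 / (4 * sqrt (real n)) \<le> r"
  shows "ennreal (real p / (16 * 4096\<^sup>2 * real n)) \<le> minimax_risk n p s0 \<tau>"
proof -
  \<comment> \<open>With \<open>4096 = 4 * 1024\<close>, the 1024 levels
    \<open>a * real (f i)\<close> stay below \<open>1 / (4 * sqrt n)\<close>. The alphabet size
    \<open>q\<close> must satisfy \<open>4 * 3 ^ p * (2 * sqrt q) ^ p \<le> q ^ p\<close> for all
    \<open>p \<ge> 1\<close>; \<open>q = 1024 = 4 * 4 * 64\<close> does, as
    \<open>2 * sqrt q = 64\<close>.\<close>
  define a where "a = 1 / (4096 * sqrt (real n))"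
  have a: "a > 0" using n by (simp add: a_def)
  have a2: "a\<^sup>2 = 1 / (4096\<^sup>2 * real n)" using n by (simp add: a_def power_divide power_mult_distrib)
  define \<Phi> where "\<Phi> f = mat p p (\<lambda>(i, j). if i = j then a * real (f i) else 0)" for f :: "nat \<Rightarrow> nat"
  let ?F = "{..<p} \<rightarrow>\<^sub>E {..<1024::nat}"
  have row: "(\<Sum>j<p. h (\<Phi> f $$ (i, j))) = h (a * real (f i))" if "i < p" "h 0 = 0" for f i and h :: "real \<Rightarrow> real"
  proof -
    have "(\<Sum>j<p. h (\<Phi> f $$ (i, j))) = (\<Sum>j<p. if j = i then h (a * real (f i)) else 0)"
      using that by (intro sum.cong) (auto simp: \<Phi>_def)
    then show ?thesis using that by simp
  qed
  have small: "small_sym_mat p r (\<Phi> f)" if f: "f \<in> ?F" for f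
    unfolding small_sym_mat_def
  proof (intro conjI allI impI)
    fix i assume i: "i < p"
    have "f i < 1024" using f i by auto
    then have "(\<Sum>j<p. \<bar>\<Phi> f $$ (i, j)\<bar>) \<le> a * 1024"
      using row[OF i, of abs] a by (simp add: abs_mult)
    also have "\<dots> \<le> r" using nr by (simp add: a_def)
    finally show "(\<Sum>j<p. \<bar>\<Phi> f $$ (i, j)\<bar>) \<le> r" .
  qed (auto simp: \<Phi>_def)
  have "ennreal (a\<^sup>2 * real (card {..<p}) / 16) \<le> minimax_risk n p s0 \<tau>"
  proof (rule minimax_risk_ge_code[where F = ?F and q = 1024 and \<Phi> = \<Phi> and K = "3 ^ p"])
    have "0 \<in> {..<p}" using p by simp
    then show "{..<p} \<noteq> {}" by blast
    fix f assume f: "f \<in> ?F"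
    show "small_sym_mat p (1/4) (\<Phi> f)" using small_sym_mat_mono[OF small[OF f]] r by simp
    show "1\<^sub>m p + \<Phi> f \<in> U_class p s0 \<tau>"
    proof (rule U_class_one_plus[OF small[OF f]])
      have e: "{(i, j). i < p \<and> j < p \<and> i \<noteq> j \<and> \<Phi> f $$ (i, j) \<noteq> 0} = {}"
        by (auto simp: \<Phi>_def)
      show "card {(i, j). i < p \<and> j < p \<and> i \<noteq> j \<and> \<Phi> f $$ (i, j) \<noteq> 0} \<le> s0"
        unfolding e by simp
      show "0 < p" using p by simp
      show "\<Phi> f $$ (0, j) = 0" if "j < p" "j \<noteq> 0" for j using that p by (simp add: \<Phi>_def)
    qed (use r in auto)
    have "frob_norm_sq p (\<Phi> f) = (\<Sum>i<p. (a * real (f i))\<^sup>2)"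
      unfolding frob_norm_sq_def by (intro sum.cong refl) (use row[where h = "\<lambda>x. x\<^sup>2"] in auto)
    also have "\<dots> \<le> (\<Sum>i<p. (a * 1024)\<^sup>2)"
      using f a by (intro sum_mono power_mono mult_left_mono) (fastforce simp: PiE_iff less_imp_le)+
    also have "\<dots> = real p / (16 * real n)"
      by (simp add: power_mult_distrib a2)
    finally have "4 * real n * frob_norm_sq p (\<Phi> f) \<le> 4 * real n * (real p / (16 * real n))"
      by (intro mult_left_mono) auto
    also have "\<dots> \<le> real p" using n by simp
    finally have "exp (4 * real n * frob_norm_sq p (\<Phi> f)) \<le> exp (real p * 1)" by simp
    also have "\<dots> = exp 1 ^ p" by (rule exp_of_nat_mult)
    also have "\<dots> \<le> 3 ^ p" by (intro power_mono exp_le) simp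
    finally show "exp (4 * real n * frob_norm_sq p (\<Phi> f)) \<le> 3 ^ p" .
  next
    fix f g assume fg: "f \<in> ?F" "g \<in> ?F"
    have "a\<^sup>2 * real (card {x \<in> {..<p}. f x \<noteq> g x}) = (\<Sum>i | i < p \<and> f i \<noteq> g i. a\<^sup>2)"
      by simp
    also have "\<dots> \<le> (\<Sum>i | i < p \<and> f i \<noteq> g i. (\<Sum>j<p. (\<Phi> f $$ (i, j) - \<Phi> g $$ (i, j))\<^sup>2))"
    proof (rule sum_mono)
      fix i assume "i \<in> {i. i < p \<and> f i \<noteq> g i}"
      then have i: "i < p" "f i \<noteq> g i" by auto
      have "1 \<le> \<bar>int (f i) - int (g i)\<bar>" using i(2) by simp
      then have "1 \<le> \<bar>real (f i) - real (g i)\<bar>" by linarith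
      then have "1 \<le> (real (f i) - real (g i))\<^sup>2" by (simp add: abs_le_square_iff[of 1, simplified])
      then have "a\<^sup>2 * 1 \<le> a\<^sup>2 * (real (f i) - real (g i))\<^sup>2" by (intro mult_left_mono) auto
      also have "\<dots> = (\<Phi> f $$ (i, i) - \<Phi> g $$ (i, i))\<^sup>2"
        using i by (simp add: \<Phi>_def power_mult_distrib[symmetric] right_diff_distrib)
      also have "\<dots> \<le> (\<Sum>j<p. (\<Phi> f $$ (i, j) - \<Phi> g $$ (i, j))\<^sup>2)"
        using i by (intro member_le_sum) auto
      finally show "a\<^sup>2 \<le> (\<Sum>j<p. (\<Phi> f $$ (i, j) - \<Phi> g $$ (i, j))\<^sup>2)" by simp
    qed
    also have "\<dots> \<le> (\<Sum>i<p. \<Sum>j<p. (\<Phi> f $$ (i, j) - \<Phi> g $$ (i, j))\<^sup>2)"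
      by (intro sum_mono2) (auto intro: sum_nonneg)
    finally show "a\<^sup>2 * real (card {x \<in> {..<p}. f x \<noteq> g x})
      \<le> (\<Sum>i<p. \<Sum>j<p. (\<Phi> f $$ (i, j) - \<Phi> g $$ (i, j))\<^sup>2)" .
  next
    have s: "sqrt 1024 = (32::real)" by (rule real_sqrt_unique) auto
    have "(4::real) * 3 ^ p * 64 ^ p \<le> 4 ^ p * 4 ^ p * 64 ^ p"
    proof (intro mult_right_mono mult_mono power_mono)
      show "(4::real) \<le> 4 ^ p" using power_increasing[of 1 p "4::real"] p by simp
    qed auto
    also have "\<dots> = 1024 ^ p" by (simp add: power_mult_distrib[symmetric])
    finally show "4 * 3 ^ p * (2 * sqrt (real 1024)) ^ card {..<p} \<le> real (card ?F)"
      by (simp add: card_PiE s)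
  qed (use a in auto)
  then show ?thesis by (simp add: a2 field_simps)
qed

section \<open>Arrays of permutation matrices\<close>

lemma mult_add_eq_iff:
  fixes w :: nat
  assumes "i < w" "j < w"
  shows "g * w + i = h * w + j \<longleftrightarrow> g = h \<and> i = j"
proof
  assume e: "g * w + i = h * w + j"
  have "(g * w + i) div w = g" "(h * w + j) div w = h" "(g * w + i) mod w = i" "(h * w + j) mod w = j"
    using assms by auto
  with e show "g = h \<and> i = j" by metis
qed auto

lemma mult_add_less:
  fixes w :: nat
  assumes "i < w" "g < k"
  shows "g * w + i < k * w"
proof -
  have "g * w + i < (g + 1) * w" using assms by simp
  also have "\<dots> \<le> k * w" using assms by (intro mult_le_mono1) auto
  finally show ?thesis .
qed

type_synonym labelling = "nat \<times> nat \<times> nat \<Rightarrow> nat"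

definition cells :: "nat \<Rightarrow> nat \<Rightarrow> (nat \<times> nat \<times> nat) set" where
  "cells k w = {..<k} \<times> {..<k} \<times> {..<w}"

text \<open>A labelling \<open>f\<close> places a permutation matrix in each block \<open>(g, h)\<close> of a \<open>k \<times> k\<close> array of
  \<open>w \<times> w\<close> blocks: row \<open>i\<close> of block \<open>(g, h)\<close> has its entry in column \<open>f (g, h, i)\<close>.\<close>
definition block_perms :: "nat \<Rightarrow> nat \<Rightarrow> labelling set" where
  "block_perms k w = {f \<in> cells k w \<rightarrow>\<^sub>E {..<w}. \<forall>g<k. \<forall>h<k. inj_on (\<lambda>i. f (g, h, i)) {..<w}}"

text \<open>The column offset \<open>k * w\<close> places the array strictly above the diagonal,
  with row and column ranges disjoint: the diagonal stays empty, and no entry is the mirror image of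
  another.\<close>

fun cell_entry :: "nat \<Rightarrow> nat \<Rightarrow> labelling \<Rightarrow> nat \<times> nat \<times> nat \<Rightarrow> nat \<times> nat" where
  "cell_entry k w f (g, h, i) = (g * w + i, k * w + (h * w + f (g, h, i)))"

definition entries :: "nat \<Rightarrow> nat \<Rightarrow> labelling \<Rightarrow> (nat \<times> nat) set" where
  "entries k w f = cell_entry k w f ` cells k w"

definition block_mat :: "nat \<Rightarrow> real \<Rightarrow> nat \<Rightarrow> nat \<Rightarrow> labelling \<Rightarrow> real mat" where
  "block_mat p a k w f = mat p p (\<lambda>(r, c). if (r, c) \<in> entries k w f \<or> (c, r) \<in> entries k w f then a else 0)"

lemma card_cells: "card (cells k w) = k * k * w"
  by (simp add: cells_def card_cartesian_product)

lemma finite_cells: "finite (cells k w)"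
  by (simp add: cells_def)

lemma finite_entries: "finite (entries k w f)"
  by (simp add: entries_def finite_cells)

lemma block_permsD:
  assumes "f \<in> block_perms k w" "g < k" "h < k" "i < w"
  shows "f (g, h, i) < w" and "j < w \<Longrightarrow> f (g, h, i) = f (g, h, j) \<Longrightarrow> i = j"
  using assms unfolding block_perms_def cells_def by (auto dest: inj_onD)

text \<open>Families of permutations, one per block, inject into the labellings:
  \<open>permutes\<close> fixes every point outside \<open>{..<w}\<close>, so restriction to
  \<open>cells\<close> loses no information.\<close>

lemma card_block_perms_ge: "card (block_perms k w) \<ge> fact w ^ (k * k)"
proof -
  let ?B = "{..<k} \<times> {..<k}"
  let ?S = "?B \<rightarrow>\<^sub>E {\<pi>. \<pi> permutes {..<w}}"
  let ?\<phi> = "\<lambda>\<sigma>. restrict (\<lambda>(g, h, i). \<sigma> (g, h) i) (cells k w)"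
  have inj: "inj_on ?\<phi> ?S"
  proof (rule inj_onI)
    fix \<sigma> \<rho> assume s: "\<sigma> \<in> ?S" and t: "\<rho> \<in> ?S" and e: "?\<phi> \<sigma> = ?\<phi> \<rho>"
    show "\<sigma> = \<rho>"
    proof (rule PiE_ext[OF s t])
      fix b assume b: "b \<in> ?B"
      have p: "\<sigma> b permutes {..<w}" "\<rho> b permutes {..<w}" using s t b by auto
      show "\<sigma> b = \<rho> b"
      proof
        fix i
        show "\<sigma> b i = \<rho> b i"
        proof (cases "i < w")
          case True
          then show ?thesis
            using fun_cong[OF e, of "(fst b, snd b, i)"] b by (auto simp: cells_def)
        next
          case False
          then show ?thesis using p by (simp add: permutes_def)
        qed
      qed
    qed
  qed
  have sub: "?\<phi> ` ?S \<subseteq> block_perms k w"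
  proof
    fix f assume "f \<in> ?\<phi> ` ?S"
    then obtain \<sigma> where s: "\<sigma> \<in> ?S" and f: "f = ?\<phi> \<sigma>" by auto
    have p: "\<sigma> (g, h) permutes {..<w}" if "g < k" "h < k" for g h using s that by auto
    have "f (g, h, i) < w" if "g < k" "h < k" "i < w" for g h i
      using permutes_in_image[OF p[OF that(1,2)], of i] that by (simp add: f cells_def)
    moreover have "inj_on (\<lambda>i. f (g, h, i)) {..<w}" if "g < k" "h < k" for g h
      using permutes_inj_on[OF p[OF that], of "{..<w}"] that by (auto simp: f cells_def inj_on_def)
    ultimately show "f \<in> block_perms k w"
      by (auto simp: block_perms_def f cells_def PiE_iff)
  qed
  have "finite (cells k w \<rightarrow>\<^sub>E {..<w})" by (intro finite_PiE finite_cells) simp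
  then have "finite (block_perms k w)" by (simp add: block_perms_def)
  then have "card (?\<phi> ` ?S) \<le> card (block_perms k w)" using sub by (intro card_mono)
  moreover have "card (?\<phi> ` ?S) = fact w ^ (k * k)"
    using inj by (simp add: card_image card_PiE card_permutations card_cartesian_product)
  ultimately show ?thesis by simp
qed

text \<open>Rows and columns are written in base \<open>w\<close>, and their digits return the
  block, the position and the label. Allowing two labellings is what the separation bound
  requires.\<close>

lemma cell_entry_eqD:
  assumes "f \<in> block_perms k w" "f' \<in> block_perms k w" "d \<in> cells k w" "d' \<in> cells k w"
    and "cell_entry k w f d = cell_entry k w f' d'"
  shows "d = d' \<and> f d = f' d'"
proof -
  obtain g h i where d: "d = (g, h, i)" by (cases d)
  obtain g' h' i' where d': "d' = (g', h', i')" by (cases d')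
  have "f d < w" "f' d' < w" using assms by (auto simp: block_perms_def)
  then show ?thesis
    using assms(3-5) unfolding d d' by (auto simp: cells_def mult_add_eq_iff)
qed

lemma entries_bounds:
  assumes f: "f \<in> block_perms k w" and "(r, c) \<in> entries k w f"
  shows "r < k * w" "k * w \<le> c" "c < 2 * (k * w)"
proof -
  obtain g h i where d: "g < k" "h < k" "i < w" "r = g * w + i" "c = k * w + (h * w + f (g, h, i))"
    using assms(2) by (auto simp: entries_def cells_def)
  show "r < k * w" "k * w \<le> c" "c < 2 * (k * w)"
    using mult_add_less[OF d(3,1)] mult_add_less[OF block_permsD(1)[OF f d(1,2,3)] d(2)] d(4,5) by auto
qed

text \<open>A row index fixes \<open>g\<close> and \<open>i\<close>, so only \<open>h\<close>
  remains free.\<close>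

lemma card_entries_row:
  assumes f: "f \<in> block_perms k w"
  shows "card {c. (r, c) \<in> entries k w f} \<le> k"
proof -
  have "{c. (r, c) \<in> entries k w f} = (\<lambda>d. snd (cell_entry k w f d)) ` {d \<in> cells k w. fst (cell_entry k w f d) = r}"
    by (force simp: entries_def)
  also have "card \<dots> \<le> card {d \<in> cells k w. fst (cell_entry k w f d) = r}"
    by (rule card_image_le) (simp add: finite_cells)
  also have "\<dots> \<le> card {..<k}"
    by (rule card_inj_on_le[where f = "\<lambda>d. fst (snd d)"])
       (auto simp: inj_on_def cells_def mult_add_eq_iff)
  finally show ?thesis by simp
qed

text \<open>A column index fixes \<open>h\<close> and the label; for each \<open>g\<close>,
  injectivity within block \<open>(g, h)\<close> then leaves at most one \<open>i\<close>.\<close>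

lemma card_entries_col:
  assumes f: "f \<in> block_perms k w"
  shows "card {r. (r, c) \<in> entries k w f} \<le> k"
proof -
  have "{r. (r, c) \<in> entries k w f} = (\<lambda>d. fst (cell_entry k w f d)) ` {d \<in> cells k w. snd (cell_entry k w f d) = c}"
    by (force simp: entries_def)
  also have "card \<dots> \<le> card {d \<in> cells k w. snd (cell_entry k w f d) = c}"
    by (rule card_image_le) (simp add: finite_cells)
  also have "\<dots> \<le> card {..<k}"
  proof (rule card_inj_on_le[where f = fst])
    show "inj_on fst {d \<in> cells k w. snd (cell_entry k w f d) = c}"
    proof (rule inj_onI)
      fix d d' assume d: "d \<in> {d \<in> cells k w. snd (cell_entry k w f d) = c}"
        "d' \<in> {d \<in> cells k w. snd (cell_entry k w f d) = c}" "fst d = fst d'"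
      obtain g h i h' i' where e: "d = (g, h, i)" "d' = (g, h', i')" using d(3) by (cases d, cases d') auto
      have b: "g < k" "h < k" "h' < k" "i < w" "i' < w" using d(1,2) by (auto simp: e cells_def)
      have "h * w + f (g, h, i) = h' * w + f (g, h', i')" using d(1,2) by (auto simp: e)
      then have "h = h'" "f (g, h, i) = f (g, h', i')"
        using mult_add_eq_iff[OF block_permsD(1)[OF f b(1,2,4)] block_permsD(1)[OF f b(1,3,5)]] by auto
      then show "d = d'" using block_permsD(2)[OF f b(1,2,4,5)] by (simp add: e)
    qed
  qed (auto simp: cells_def)
  finally show ?thesis by simp
qed

lemma small_sym_block_mat:
  assumes f: "f \<in> block_perms k w" and a: "a \<ge> 0"
  shows "small_sym_mat p (2 * real k * a) (block_mat p a k w f)"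
  unfolding small_sym_mat_def
proof (intro conjI allI impI)
  fix r assume r: "r < p"
  let ?R = "{c. (r, c) \<in> entries k w f}" and ?C = "{c. (c, r) \<in> entries k w f}"
  have "?R \<subseteq> snd ` entries k w f" by force
  then have fR: "finite ?R" by (rule finite_subset) (intro finite_imageI finite_entries)
  have "?C \<subseteq> fst ` entries k w f" by force
  then have fC: "finite ?C" by (rule finite_subset) (intro finite_imageI finite_entries)
  have "(\<Sum>c<p. \<bar>block_mat p a k w f $$ (r, c)\<bar>) = (\<Sum>c\<in>{..<p} \<inter> (?R \<union> ?C). a)"
    unfolding sum.inter_restrict[OF finite_lessThan]
    using r a by (intro sum.cong refl) (simp add: block_mat_def)
  also have "\<dots> \<le> real (card (?R \<union> ?C)) * a"
    using a fR fC by (simp add: mult_right_mono card_mono)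
  also have "\<dots> \<le> (2 * real k) * a"
  proof (rule mult_right_mono[OF _ a])
    \<comment> \<open>A row below \<open>k * w\<close> meets only \<open>?R\<close> and a later one
      only \<open>?C\<close>; adding both bounds avoids this case distinction for a factor
      2.\<close>
    have "card (?R \<union> ?C) \<le> card ?R + card ?C" by (rule card_Un_le)
    also have "\<dots> \<le> k + k" by (intro add_mono card_entries_row card_entries_col f)
    finally show "real (card (?R \<union> ?C)) \<le> 2 * real k" by linarith
  qed
  finally show "(\<Sum>c<p. \<bar>block_mat p a k w f $$ (r, c)\<bar>) \<le> 2 * real k * a" .
qed (auto simp: block_mat_def)

definition sym_entries :: "nat \<Rightarrow> nat \<Rightarrow> labelling \<Rightarrow> (nat \<times> nat) set" where
  "sym_entries k w f = entries k w f \<union> prod.swap ` entries k w f"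

lemma mem_sym_entries: "(r, c) \<in> sym_entries k w f \<longleftrightarrow> (r, c) \<in> entries k w f \<or> (c, r) \<in> entries k w f"
  by (simp add: sym_entries_def)

lemma card_sym_entries: "card (sym_entries k w f) \<le> 2 * (k * k * w)"
proof -
  have "card (sym_entries k w f) \<le> card (entries k w f) + card (prod.swap ` entries k w f)"
    unfolding sym_entries_def by (rule card_Un_le)
  also have "card (prod.swap ` entries k w f) \<le> card (entries k w f)"
    by (rule card_image_le[OF finite_entries])
  also have "card (entries k w f) \<le> k * k * w"
    unfolding entries_def card_cells[symmetric] by (rule card_image_le[OF finite_cells])
  finally show ?thesis by simp
qed

lemma finite_sym_entries: "finite (sym_entries k w f)"
  by (simp add: sym_entries_def finite_entries)

lemma frob_norm_block_mat:
  "frob_norm_sq p (block_mat p a k w f) \<le> 2 * real (k * k * w) * a\<^sup>2"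
proof -
  have "frob_norm_sq p (block_mat p a k w f)
      = (\<Sum>x\<in>{..<p} \<times> {..<p}. if x \<in> sym_entries k w f then a\<^sup>2 else 0)"
    unfolding frob_norm_sq_def sum.cartesian_product
    by (intro sum.cong) (auto simp: block_mat_def mem_sym_entries)
  also have "\<dots> = real (card ({..<p} \<times> {..<p} \<inter> sym_entries k w f)) * a\<^sup>2"
    by (subst sum.inter_restrict[symmetric]) auto
  also have "\<dots> \<le> real (2 * (k * k * w)) * a\<^sup>2"
    by (intro mult_right_mono of_nat_mono order_trans[OF card_mono card_sym_entries])
       (auto simp: finite_sym_entries)
  finally show ?thesis by simp
qed

text \<open>Each cell where the labellings differ yields an entry of the first matrix that is absent
  from the second, and distinct cells yield distinct positions.\<close>

lemma block_mat_separation: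
  assumes f: "f \<in> block_perms k w" and f': "f' \<in> block_perms k w" and p: "2 * (k * w) \<le> p"
  shows "a\<^sup>2 * real (card {x \<in> cells k w. f x \<noteq> f' x})
    \<le> (\<Sum>i<p. \<Sum>j<p. (block_mat p a k w f $$ (i, j) - block_mat p a k w f' $$ (i, j))\<^sup>2)"
proof -
  let ?D = "{x \<in> cells k w. f x \<noteq> f' x}"
  let ?s = "\<lambda>(i, j). (block_mat p a k w f $$ (i, j) - block_mat p a k w f' $$ (i, j))\<^sup>2"
  have inj: "inj_on (cell_entry k w f) ?D"
    by (rule inj_onI) (use cell_entry_eqD[OF f f] in blast)
  have val: "cell_entry k w f d \<in> {..<p} \<times> {..<p} \<and> ?s (cell_entry k w f d) = a\<^sup>2" if d: "d \<in> ?D" for d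
  proof -
    obtain r c where rc: "cell_entry k w f d = (r, c)" by (cases "cell_entry k w f d")
    have e: "(r, c) \<in> entries k w f" using d rc by (force simp: entries_def)
    note b = entries_bounds[OF f e]
    \<comment> \<open>The mirrored condition in \<open>block_mat\<close> would need \<open>c\<close>
      as a row index, but \<open>c \<ge> k * w\<close>.\<close>
    have n1: "(c, r) \<notin> entries k w f'" using entries_bounds(1)[OF f', of c r] b by auto
    have n2: "(r, c) \<notin> entries k w f'"
    proof
      assume "(r, c) \<in> entries k w f'"
      then obtain d' where d': "d' \<in> cells k w" "cell_entry k w f' d' = (r, c)" by (auto simp: entries_def)
      then have "d = d' \<and> f d = f' d'" using cell_entry_eqD[OF f f' _ d'(1)] d rc by auto
      then show False using d by auto
    qed
    show ?thesis using b p e n1 n2 by (simp add: rc block_mat_def)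
  qed
  have "a\<^sup>2 * real (card ?D) = (\<Sum>d\<in>?D. ?s (cell_entry k w f d))"
    using val by simp
  also have "\<dots> = (\<Sum>x\<in>cell_entry k w f ` ?D. ?s x)"
    using sum.reindex[OF inj, of ?s] by (simp add: o_def)
  also have "\<dots> \<le> (\<Sum>x\<in>{..<p} \<times> {..<p}. ?s x)"
    using val by (intro sum_mono2) auto
  also have "\<dots> = (\<Sum>i<p. \<Sum>j<p. (block_mat p a k w f $$ (i, j) - block_mat p a k w f' $$ (i, j))\<^sup>2)"
    by (simp add: sum.cartesian_product)
  finally show ?thesis .
qed

lemma minimax_risk_ge_block:
  assumes k: "k \<ge> 1" and w: "w \<ge> 1" and p: "2 * (k * w) < p" and s0: "2 * (k * k * w) \<le> s0"
    and a: "a > 0" and r: "2 * real k * a \<le> r" "r \<le> 1/4" "1 + r \<le> \<tau>" "1 / \<tau> \<le> 1 - r"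
    and large: "4 * exp (8 * real n * a\<^sup>2 * real (k * k * w)) * (2 * sqrt (real w)) ^ (k * k * w)
      \<le> real (fact w ^ (k * k))"
  shows "ennreal (a\<^sup>2 * real (k * k * w) / 16) \<le> minimax_risk n p s0 \<tau>"
proof -
  have "ennreal (a\<^sup>2 * real (card (cells k w)) / 16) \<le> minimax_risk n p s0 \<tau>"
  proof (rule minimax_risk_ge_code[where F = "block_perms k w" and q = w and \<Phi> = "block_mat p a k w"
        and K = "exp (8 * real n * a\<^sup>2 * real (k * k * w))"])
    show "finite (cells k w)" by (rule finite_cells)
    have "(0, 0, 0) \<in> cells k w" using k w by (simp add: cells_def)
    then show "cells k w \<noteq> {}" by blast
    show "block_perms k w \<subseteq> cells k w \<rightarrow>\<^sub>E {..<w}" by (auto simp: block_perms_def)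
    show "1 \<le> w" by (rule w)
    have "real (fact w ^ (k * k)) \<le> real (card (block_perms k w))"
      using card_block_perms_ge[of w k] by (simp only: of_nat_le_iff)
    with large show "4 * exp (8 * real n * a\<^sup>2 * real (k * k * w)) * (2 * sqrt (real w)) ^ card (cells k w)
        \<le> real (card (block_perms k w))"
      by (simp only: card_cells)
    fix f assume f: "f \<in> block_perms k w"
    have small: "small_sym_mat p r (block_mat p a k w f)"
      by (rule small_sym_mat_mono[OF small_sym_block_mat[OF f]]) (use a r in auto)
    show "small_sym_mat p (1/4) (block_mat p a k w f)"
      by (rule small_sym_mat_mono[OF small r(2)])
    show "1\<^sub>m p + block_mat p a k w f \<in> U_class p s0 \<tau>"
    proof (rule U_class_one_plus[OF small])
      have "card {(i, j). i < p \<and> j < p \<and> i \<noteq> j \<and> block_mat p a k w f $$ (i, j) \<noteq> 0} \<le> card (sym_entries k w f)"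
        by (intro card_mono finite_sym_entries) (auto simp: block_mat_def mem_sym_entries split: if_splits)
      also have "\<dots> \<le> s0" using card_sym_entries s0 by (rule order_trans)
      finally show "card {(i, j). i < p \<and> j < p \<and> i \<noteq> j \<and> block_mat p a k w f $$ (i, j) \<noteq> 0} \<le> s0" .
      \<comment> \<open>The strict bound \<open>2 * (k * w) < p\<close> keeps the last index outside
        the array, so it is the uncoupled one.\<close>
      show "p - 1 < p" using p by simp
      have "(p - 1, j) \<notin> entries k w f" "(j, p - 1) \<notin> entries k w f" for j
        using entries_bounds[OF f, of "p - 1" j] entries_bounds[OF f, of j "p - 1"] p by auto
      then show "block_mat p a k w f $$ (p - 1, j) = 0" if "j < p" "j \<noteq> p - 1" for j
        using that by (simp add: block_mat_def)
    qed (use r in auto)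
    have "4 * real n * frob_norm_sq p (block_mat p a k w f) \<le> 4 * real n * (2 * real (k * k * w) * a\<^sup>2)"
      by (intro mult_left_mono frob_norm_block_mat) simp
    then show "exp (4 * real n * frob_norm_sq p (block_mat p a k w f)) \<le> exp (8 * real n * a\<^sup>2 * real (k * k * w))"
      by (simp add: mult_ac)
  next
    fix f g assume fg: "f \<in> block_perms k w" "g \<in> block_perms k w"
    show "a\<^sup>2 * real (card {x \<in> cells k w. f x \<noteq> g x})
      \<le> (\<Sum>i<p. \<Sum>j<p. (block_mat p a k w f $$ (i, j) - block_mat p a k w g $$ (i, j))\<^sup>2)"
      by (rule block_mat_separation[OF fg]) (use p in simp)
  qed (use a in auto)
  then show ?thesis by (simp add: card_cells)
qed

section \<open>The rates\<close>

text \<open>\<open>w ^ w / fact w\<close> is a single term of the exponential series at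
  \<open>w\<close>, and \<open>exp 1 \<le> 3\<close>.\<close>

lemma fact_ge_power: "(real w / 3) ^ w \<le> fact w"
proof -
  have "real w ^ w /\<^sub>R fact w \<le> exp (real w)"
    unfolding exp_def
    using sum_le_suminf[OF summable_exp_generic[of "real w"], of "{w}"] by simp
  also have "\<dots> = exp 1 ^ w" using exp_of_nat_mult[of w "1::real"] by simp
  also have "\<dots> \<le> 3 ^ w" by (intro power_mono exp_le) simp
  finally show ?thesis by (simp add: power_divide field_simps)
qed

text \<open>Let \<open>t\<close> be the fourth root of \<open>w\<close>. Per cell, the left side is
  at most \<open>4 * t * (2 * t\<^sup>2) = 8 * t ^ 3\<close> and the right side at least
  \<open>t ^ 4 / 3\<close>. The comparison holds for \<open>t \<ge> 24\<close>, and
  \<open>24 ^ 4 = 331776\<close>.\<close>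

lemma block_family_large:
  assumes w: "w \<ge> 331776" and k: "k \<ge> 1"
  shows "4 * exp (ln (real w) / 4 * real (k * k * w)) * (2 * sqrt (real w)) ^ (k * k * w) \<le> real (fact w ^ (k * k))"
proof -
  define N where "N = k * k * w"
  define t where "t = sqrt (sqrt (real w))"
  have N: "N \<ge> 1" using w k by (simp add: N_def Suc_leI)
  have t2: "t\<^sup>2 = sqrt (real w)" by (simp add: t_def)
  have t4: "t ^ 4 = real w"
  proof -
    have "t ^ 4 = (t\<^sup>2)\<^sup>2" by (simp add: power_mult[symmetric])
    then show ?thesis by (simp add: t2)
  qed
  have t: "t \<ge> 24" unfolding t_def by (intro real_le_rsqrt) (use w in simp)
  have "ln (real w) / 4 = ln t"
    using t unfolding t4[symmetric] by (simp add: ln_realpow)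
  then have e: "exp (ln (real w) / 4 * real N) = t ^ N"
    using exp_of_nat_mult[of N "ln t"] t by (simp only: mult.commute[of "ln t"]) (simp add: exp_ln)
  have "4 * t ^ N * (2 * sqrt (real w)) ^ N \<le> 4 ^ N * t ^ N * (2 * t\<^sup>2) ^ N"
    unfolding t2 using t power_increasing[OF N, of "4::real"] by (intro mult_right_mono) auto
  also have "\<dots> = (4 * t * (2 * t\<^sup>2)) ^ N" by (simp only: power_mult_distrib)
  also have "4 * t * (2 * t\<^sup>2) = 8 * t ^ 3" by (simp add: power3_eq_cube power2_eq_square)
  also have "(8 * t ^ 3) ^ N \<le> (t ^ 4 / 3) ^ N"
  proof (rule power_mono)
    have "t ^ 3 * 24 \<le> t ^ 3 * t" using t by (intro mult_left_mono) auto
    then show "8 * t ^ 3 \<le> t ^ 4 / 3" by (simp add: eval_nat_numeral mult_ac)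
  qed (use t in simp)
  also have "\<dots> = ((real w / 3) ^ w) ^ (k * k)"
    by (simp only: t4 N_def power_mult[symmetric] mult_ac)
  also have "\<dots> \<le> fact w ^ (k * k)" by (intro power_mono fact_ge_power) simp
  finally show ?thesis using e by (simp add: N_def)
qed

lemma minimax_risk_ge_sparse:
  fixes p s0 n :: nat
  assumes s0: "3 * p < s0" and n: "n \<ge> 1"
    and r: "r > 0" "r \<le> 1/4" "1 + r \<le> \<tau>" "1 / \<tau> \<le> 1 - r"
    and h1: "(real s0)\<^sup>2 * ln (real p) ^ 3 \<le> C1 * ((real p)\<^sup>2 * real n)"
    and h2: "(real s0)\<^sup>2 \<le> C2 * real p powr (3 - \<epsilon>)"
    and large: "331776 \<le> sqrt (real p)" "256 * C2 \<le> real p powr \<epsilon>" "C1 \<le> 8 * r\<^sup>2 * (ln (real p))\<^sup>2"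
  shows "ennreal (real s0 * ln (real p) / real n / 8192) \<le> minimax_risk n p s0 \<tau>"
proof -
  \<comment> \<open>About \<open>s0 / p\<close> nonzero entries per row use up the sparsity budget.
    The width \<open>w\<close> is then the largest with \<open>2 * k * w \<le> p - 1\<close>, which
    reserves one index to stay uncoupled.\<close>
  define k where "k = s0 div p"
  define w where "w = (p - 1) div (2 * k)"
  have p: "real p \<ge> 331776\<^sup>2" using power_mono[OF large(1), of 2] by simp
  then have p1: "p > 1" by (simp add: power2_eq_square)
  have lnp: "ln (real p) > 0" using p1 by simp
  have kp: "k * p \<le> s0" by (simp add: k_def)
  have "3 * p div p \<le> s0 div p" using s0 by (intro div_le_mono) simp
  then have k3: "k \<ge> 3" using p1 by (simp add: k_def)
  have "s0 < (k + 1) * p" using p1 dividend_less_div_times[of p s0] by (simp add: k_def)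
  also have "\<dots> \<le> 2 * (k * p)" using k3 by simp
  finally have s0k: "real s0 \<le> 2 * (real k * real p)"
    using of_nat_mono[of s0 "2 * (k * p)", where 'a = real] by simp
  have kp': "real k * real p \<le> real s0" using of_nat_mono[OF kp, where 'a = real] by simp
  have k2: "(real k)\<^sup>2 * (real p)\<^sup>2 \<le> (real s0)\<^sup>2"
    using power_mono[OF kp', of 2] by (simp add: power_mult_distrib)
  \<comment> \<open>After division by \<open>(real p)\<^sup>2\<close>, \<open>h2\<close> bounds
    \<open>k\<^sup>2\<close> by \<open>C2 * p powr (1 - \<epsilon>)\<close>, and
    \<open>p powr \<epsilon>\<close> outweighs \<open>256 * C2\<close>.\<close>
  have "(16 * real k)\<^sup>2 \<le> real p"
  proof -
    have "(real k)\<^sup>2 * (real p)\<^sup>2 * (256 * real p powr \<epsilon>) \<le> (C2 * real p powr (3 - \<epsilon>)) * (256 * real p powr \<epsilon>)"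
      using k2 h2 by (intro mult_right_mono) auto
    also have "\<dots> = 256 * C2 * (real p powr (3 - \<epsilon>) * real p powr \<epsilon>)" by simp
    also have "real p powr (3 - \<epsilon>) * real p powr \<epsilon> = real p ^ 3"
      using p1 by (simp add: powr_add[symmetric])
    also have "256 * C2 * real p ^ 3 \<le> real p powr \<epsilon> * real p ^ 3"
      by (intro mult_right_mono large) simp
    also have "\<dots> = real p * (real p)\<^sup>2 * real p powr \<epsilon>" by (simp add: eval_nat_numeral)
    finally have "(256 * (real k)\<^sup>2) * ((real p)\<^sup>2 * real p powr \<epsilon>) \<le> real p * ((real p)\<^sup>2 * real p powr \<epsilon>)"
      by (simp add: mult_ac)
    then have "256 * (real k)\<^sup>2 \<le> real p"
      using p1 by (subst (asm) mult_le_cancel_right_pos) auto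
    then show ?thesis by (simp add: power_mult_distrib)
  qed
  then have k16: "16 * real k \<le> sqrt (real p)" by (rule real_le_rsqrt)
  define q where "q = sqrt (real p)"
  have q2: "real p = q * q" by (simp add: q_def)
  have q: "q \<ge> 331776" using large by (simp add: q_def)
  have kq: "16 * real k \<le> q" using k16 by (simp add: q_def)
  have "p - 1 < (w + 1) * (2 * k)"
    using k3 dividend_less_div_times[of "2 * k" "p - 1"] by (simp add: w_def)
  then have "p \<le> (w + 1) * (2 * k)" by linarith
  then have pw: "q * q \<le> (real w + 1) * (2 * real k)"
    unfolding q2[symmetric] using of_nat_mono[of p "(w + 1) * (2 * k)", where 'a = real]
    by (simp add: algebra_simps)
  \<comment> \<open>From \<open>p \<le> (w + 1) * 2 * k\<close> and
    \<open>2 * k \<le> sqrt p / 8\<close> the blocks turn out at least \<open>sqrt p\<close> wide,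
    whence \<open>ln w \<ge> ln p / 2\<close>.\<close>
  have "q * q \<le> (real w + 1) * (q / 8)"
    using pw mult_left_mono[of "2 * real k" "q / 8" "real w + 1"] kq by linarith
  then have "q * (8 * q) \<le> q * (real w + 1)" by (simp add: mult_ac)
  then have "8 * q \<le> real w + 1" using q by simp
  then have wq: "q \<le> real w" using q by linarith
  have w: "w \<ge> 331776" using wq q by linarith
  have "w * (2 * k) \<le> p - 1" by (simp add: w_def)
  then have wkp: "2 * (k * w) < p" using p1 by (simp add: mult_ac)
  have "w \<le> k * w" using k3 by simp
  then have "w \<le> p" using wkp by linarith
  then have lnw: "ln (real w) \<le> ln (real p)" using w by simp
  have lnw2: "ln (real p) / 2 \<le> ln (real w)"
  proof -
    have "ln (real p) / 2 = ln q" using p1 by (simp add: q_def ln_sqrt)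
    also have "\<dots> \<le> ln (real w)" using wq q by simp
    finally show ?thesis .
  qed
  \<comment> \<open>Chosen so that \<open>8 * n * a\<^sup>2 = ln w / 4\<close>, the exponent per
    cell that \<open>block_family_large\<close> affords.\<close>
  define a where "a = sqrt (ln (real w) / (32 * real n))"
  have lnw0: "ln (real w) > 0" using w by simp
  have a: "a > 0" using lnw0 n by (simp add: a_def)
  have a2: "a\<^sup>2 = ln (real w) / (32 * real n)" using lnw0 n by (simp add: a_def)
  \<comment> \<open>After division by \<open>p\<^sup>2\<close>, \<open>h1\<close> reads
    \<open>k\<^sup>2 * ln p ^ 3 \<le> C1 * n\<close>; two of the logarithms pay for
    \<open>C1 / (8 * r\<^sup>2)\<close> and the third covers \<open>ln w\<close> from
    \<open>a\<^sup>2\<close>.\<close>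
  have small: "2 * real k * a \<le> r"
  proof -
    have "(real k)\<^sup>2 * ln (real p) * ((real p)\<^sup>2 * (ln (real p))\<^sup>2) = (real k)\<^sup>2 * (real p)\<^sup>2 * ln (real p) ^ 3"
      by (simp add: eval_nat_numeral)
    also have "\<dots> \<le> (real s0)\<^sup>2 * ln (real p) ^ 3" using k2 lnp by (intro mult_right_mono) auto
    also have "\<dots> \<le> C1 * ((real p)\<^sup>2 * real n)" by (rule h1)
    also have "\<dots> \<le> 8 * r\<^sup>2 * (ln (real p))\<^sup>2 * ((real p)\<^sup>2 * real n)" by (intro mult_right_mono large) simp
    also have "\<dots> = 8 * r\<^sup>2 * real n * ((real p)\<^sup>2 * (ln (real p))\<^sup>2)" by (simp add: mult_ac)
    finally have "(real k)\<^sup>2 * ln (real p) \<le> 8 * r\<^sup>2 * real n"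
      using p1 lnp by (subst (asm) mult_le_cancel_right_pos) auto
    moreover have "(real k)\<^sup>2 * ln (real w) \<le> (real k)\<^sup>2 * ln (real p)" using lnw by (intro mult_left_mono) auto
    ultimately have "(real k)\<^sup>2 * ln (real w) \<le> 8 * r\<^sup>2 * real n" by linarith
    then have "(2 * real k * a)\<^sup>2 \<le> r\<^sup>2" using n by (simp add: power_mult_distrib a2 field_simps)
    then show ?thesis by (rule power2_le_imp_le) (use r in simp)
  qed
  define N where "N = k * k * w"
  have main: "ennreal (a\<^sup>2 * real (k * k * w) / 16) \<le> minimax_risk n p s0 \<tau>"
  proof (rule minimax_risk_ge_block[OF _ _ wkp _ a small r(2-4)])
    have "2 * (k * k * w) = k * (2 * (k * w))" by simp
    also have "\<dots> \<le> k * p" using wkp by (intro mult_le_mono2) simp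
    also note kp
    finally show "2 * (k * k * w) \<le> s0" .
    have e: "8 * real n * a\<^sup>2 = ln (real w) / 4" using n by (simp add: a2)
    show "4 * exp (8 * real n * a\<^sup>2 * real (k * k * w)) * (2 * sqrt (real w)) ^ (k * k * w) \<le> real (fact w ^ (k * k))"
      unfolding e by (rule block_family_large[OF w]) (use k3 in simp)
  qed (use k3 w in auto)
  \<comment> \<open>Both roundings lose constants only: \<open>s0 \<le> 2 * k * p\<close> and
    \<open>p \<le> 4 * k * w\<close>.\<close>
  have N: "real s0 \<le> 8 * real N"
  proof -
    have "2 * real k \<le> q * q / 2"
    proof -
      have "q * 1 \<le> q * q" using q by (intro mult_left_mono) auto
      then show ?thesis using kq by simp
    qed
    then have "q * q / 2 \<le> real w * (2 * real k)" using pw by (simp add: algebra_simps)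
    then have "real k * (q * q / 2) \<le> real k * (real w * (2 * real k))" by (intro mult_left_mono) auto
    then show ?thesis using s0k by (simp add: N_def q2 mult_ac)
  qed
  \<comment> \<open>\<open>8192 = 8 * 2 * 512\<close>: 8 from \<open>s0 \<le> 8 * N\<close>, 2 from
    \<open>ln p \<le> 2 * ln w\<close>, and \<open>512 = 32 * 16\<close> from
    \<open>a\<^sup>2\<close> and the packing bound.\<close>
  have "real s0 * ln (real p) / real n / 8192 = (real s0 / 8) * (ln (real p) / 2) / (512 * real n)" by simp
  also have "\<dots> \<le> real N * ln (real w) / (512 * real n)"
    using N lnw2 lnp by (intro divide_right_mono mult_mono) auto
  also have "\<dots> = a\<^sup>2 * real (k * k * w) / 16" by (simp add: a2 N_def field_simps)
  finally show ?thesis using main by (meson ennreal_leI order_trans)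
qed

lemma ennreal_le_cmult:
  assumes "ennreal (x / c) \<le> m" "c > 0"
  shows "ennreal x \<le> ennreal c * m"
proof -
  have "ennreal x = ennreal (c * (x / c))" using assms(2) by simp
  also have "\<dots> = ennreal c * ennreal (x / c)" using assms(2) by (intro ennreal_mult') simp
  also have "\<dots> \<le> ennreal c * m" using assms(1) by (intro mult_left_mono) auto
  finally show ?thesis .
qed

theorem theorem2:
  fixes p s0 :: "nat \<Rightarrow> nat" and \<tau>0 :: real
  assumes tau: "\<tau>0 > 1"
    and p_pos: "\<And>n. p n \<ge> 1"
    and s0_pos: "\<And>n. s0 n \<ge> 1"
    and h1: "(\<lambda>n. real (s0 n) ^ 2 * ln (real (p n)) ^ 3) \<in> O(\<lambda>n. real (p n) ^ 2 * real n)"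
    and h2: "\<exists>\<epsilon>>0. (\<lambda>n. real (s0 n) ^ 2) \<in> O(\<lambda>n. real (p n) powr (3 - \<epsilon>))"
  shows "\<exists>C>0. \<forall>\<^sub>F n in sequentially.
           ennreal (real (s0 n) * ln (real (p n)) / real n * (if s0 n > 3 * p n then 1 else 0)
                    + real (p n) / real n)
           \<le> ennreal C * minimax_risk n (p n) (s0 n) \<tau>0"
proof -
  define r where "r = min (1/4) (1 - 1 / \<tau>0)"
  have r_le: "r \<le> 1 - 1 / \<tau>0" unfolding r_def by (rule min.cobounded2)
  have r: "r > 0" "r \<le> 1/4" "1 / \<tau>0 \<le> 1 - r"
    using tau r_le unfolding r_def by (simp, intro min.cobounded1, linarith)
  \<comment> \<open>As \<open>\<tau>0 + 1 / \<tau>0 \<ge> 2\<close>, the upper eigenvalue bound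
    follows from \<open>r \<le> 1 - 1 / \<tau>0\<close>, the condition for the lower one.\<close>
  have "0 \<le> (\<tau>0 - 1)\<^sup>2 / \<tau>0" using tau by simp
  also have "\<dots> = \<tau>0 + 1 / \<tau>0 - 2" using tau by (simp add: power2_eq_square field_simps)
  finally have r': "1 + r \<le> \<tau>0" using r_le by linarith
  obtain C1 where C1: "C1 > 0"
    "\<forall>\<^sub>F n in sequentially. norm (real (s0 n) ^ 2 * ln (real (p n)) ^ 3) \<le> C1 * norm (real (p n) ^ 2 * real n)"
    using h1 by (elim landau_o.bigE)
  obtain \<epsilon> where eps: "\<epsilon> > 0" "(\<lambda>n. real (s0 n) ^ 2) \<in> O(\<lambda>n. real (p n) powr (3 - \<epsilon>))"
    using h2 by auto
  obtain C2 where C2: "C2 > 0"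
    "\<forall>\<^sub>F n in sequentially. norm (real (s0 n) ^ 2) \<le> C2 * norm (real (p n) powr (3 - \<epsilon>))"
    using eps(2) by (elim landau_o.bigE)
  \<comment> \<open>The size requirements are stated for a real variable, since \<open>p n\<close>
    need not tend to infinity; they are applied at \<open>p n\<close> whenever it reaches the
    threshold \<open>P\<close>.\<close>
  have "\<forall>\<^sub>F x in at_top. 331776 \<le> sqrt (x::real)" by real_asymp
  moreover have "\<forall>\<^sub>F x in at_top. 256 * C2 \<le> (x::real) powr \<epsilon>" using eps(1) by real_asymp
  moreover have "\<forall>\<^sub>F x in at_top. C1 \<le> 8 * r\<^sup>2 * (ln (x::real))\<^sup>2" using r(1) by real_asymp
  ultimately have "\<forall>\<^sub>F x in at_top. 331776 \<le> sqrt (x::real) \<and> 256 * C2 \<le> x powr \<epsilon> \<and> C1 \<le> 8 * r\<^sup>2 * (ln x)\<^sup>2"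
    by eventually_elim auto
  then obtain P where P: "\<And>x::real. x \<ge> P \<Longrightarrow> 331776 \<le> sqrt x \<and> 256 * C2 \<le> x powr \<epsilon> \<and> C1 \<le> 8 * r\<^sup>2 * (ln x)\<^sup>2"
    by (auto simp: eventually_at_top_linorder)
  define B where "B = C2 * \<bar>P\<bar> ^ 3"
  define K where "K = (16 * 4096\<^sup>2 :: real)"
  have B: "B \<ge> 0" using C2(1) by (simp add: B_def)
  have K: "K > 0" by (simp add: K_def)
  have "\<forall>\<^sub>F n in sequentially. 1 / (4 * sqrt (real n)) \<le> r" using r(1) by real_asymp
  moreover have "\<forall>\<^sub>F n in sequentially. n \<ge> 1" by (rule eventually_ge_at_top)
  ultimately have "\<forall>\<^sub>F n in sequentially.
           ennreal (real (s0 n) * ln (real (p n)) / real n * (if s0 n > 3 * p n then 1 else 0)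
                    + real (p n) / real n)
           \<le> ennreal (8192 + B * K + K) * minimax_risk n (p n) (s0 n) \<tau>0"
    using C1(2) C2(2)
  proof eventually_elim
    case (elim n)
    let ?m = "minimax_risk n (p n) (s0 n) \<tau>0"
    define x where "x = real (s0 n) * ln (real (p n)) / real n"
    define y where "y = real (p n) / real n"
    have xy: "x \<ge> 0" "y \<ge> 0" using p_pos[of n] by (auto simp: x_def y_def)
    have "ennreal (y / K) \<le> ?m"
      using minimax_risk_ge_diag[OF p_pos[of n] elim(2) r(2) r' r(3) elim(1)]
      by (simp add: y_def K_def mult_ac)
    then have y: "ennreal y \<le> ennreal K * ?m" by (rule ennreal_le_cmult[OF _ K])
    have x: "ennreal (x * (if s0 n > 3 * p n then 1 else 0)) \<le> ennreal (8192 + B * K) * ?m"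
    proof (cases "s0 n > 3 * p n")
      case big: True
      show ?thesis
      proof (cases "real (p n) \<ge> P")
        case True
        have "ennreal (x / 8192) \<le> ?m"
          unfolding x_def
          by (rule minimax_risk_ge_sparse[OF big elim(2) r(1,2) r' r(3), of C1 C2 \<epsilon>])
             (use elim(3,4) P[OF True] p_pos[of n] in auto)
        then have "ennreal x \<le> ennreal 8192 * ?m" by (rule ennreal_le_cmult) simp
        also have "\<dots> \<le> ennreal (8192 + B * K) * ?m"
          using B K by (intro mult_right_mono ennreal_leI) auto
        finally show ?thesis using big by simp
      next
        \<comment> \<open>For \<open>p n < P\<close>, \<open>h2\<close> bounds \<open>s0 n\<close>
          by the constant \<open>B\<close>. With \<open>ln p \<le> p\<close> the sparse term is at
          most \<open>B\<close> times \<open>p / n\<close>, so the diagonal bound already covers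
          it.\<close>
        case False
        have p1: "real (p n) \<ge> 1" using p_pos[of n] by simp
        have "real (s0 n) * 1 \<le> real (s0 n) * real (s0 n)" using s0_pos[of n] by (intro mult_left_mono) auto
        also have "\<dots> \<le> C2 * real (p n) powr (3 - \<epsilon>)" using elim(4) by (simp add: power2_eq_square)
        also have "\<dots> \<le> C2 * real (p n) powr 3"
          using C2(1) eps(1) p1 by (intro mult_left_mono powr_mono) auto
        also have "\<dots> = C2 * real (p n) ^ 3" using p1 by simp
        also have "\<dots> \<le> B" unfolding B_def using False C2(1) by (intro mult_left_mono power_mono) auto
        finally have s: "real (s0 n) \<le> B" by simp
        have "ln (real (p n)) \<le> real (p n)" using ln_le_minus_one[of "real (p n)"] p1 by simp
        then have "real (s0 n) * ln (real (p n)) \<le> B * real (p n)" using s B p1 by (intro mult_mono) auto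
        then have "x \<le> B * y" unfolding x_def y_def by (simp add: divide_right_mono)
        then have "ennreal x \<le> ennreal B * ennreal y" using B by (simp add: ennreal_mult'[symmetric] ennreal_leI)
        also have "\<dots> \<le> ennreal B * (ennreal K * ?m)" by (intro mult_left_mono y) simp
        also have "\<dots> = ennreal (B * K) * ?m" using B K by (simp add: ennreal_mult mult_ac)
        also have "\<dots> \<le> ennreal (8192 + B * K) * ?m" by (intro mult_right_mono ennreal_leI) auto
        finally show ?thesis using big by simp
      qed
    qed simp
    have "ennreal (x * (if s0 n > 3 * p n then 1 else 0) + y)
        = ennreal (x * (if s0 n > 3 * p n then 1 else 0)) + ennreal y"
      using xy by (intro ennreal_plus) auto
    also have "\<dots> \<le> ennreal (8192 + B * K) * ?m + ennreal K * ?m" by (intro add_mono x y)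
    also have "\<dots> = ennreal (8192 + B * K + K) * ?m"
      using B K by (simp add: ennreal_plus distrib_right)
    finally show ?case by (simp add: x_def y_def)
  qed
  moreover have "8192 + B * K + K > 0" using B K by (simp add: add_pos_nonneg add_nonneg_pos)
  ultimately show ?thesis by blast
qed

end
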